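(* Let $(G,d)$ be a doubling, complete metric group with dilations, and let $\mathcal{S}=\{S_1,\dots,S_N\}$, $N\ge2$, be an iterated function system on $G$ with $S_i=\tau_{q_i}\circ\delta_{r_i}$, $q_i\in G$, $r_i\in(0,1)$, which satisfies the open set condition and generates an $s$-dimensional self-similar set $C$. Let $\mu=\mathcal{H}^s(C)^{-1}\mathcal{H}^s\lfloor C$ and let $k$ be an $s$-homogeneous kernel on $G$. If there exist a word $w\in E^*$ and a periodic point $x_w\in C$, $S_w(x_w)=x_w$, such that $x_w\in O$ for some open set $O$ for which $\mathcal{S}$ satisfies the strong open set condition, and $$\int_{C\setminus C_w}k(x_w,y)\,d\mu(y)\neq0,$$ then $T^*(1)(x)=\infty$ for $\mu$-a.e. $x$.
   Context: Metric group with dilations: $(G,d)$ is a complete metric group such that (1) the left translations $\tau_q(x)=q\cdot x$ are isometries for all $q\in G$; (2) there are dilations $\delta_r:G\to G$, $r>0$, which are continuous group homomorphisms with $\delta_1=\mathrm{id}$, $d(\delta_r(x),\delta_r(y))=r\,d(x,y)$ and $\delta_{rs}=\delta_r\circ\delta_s$. Doubling means: there is $M\in\mathbb{N}$ such that every ball $B(x,r)$ is covered by at most $M$ balls of radius $r/2$. $B(x,r)$ denotes the closed ball, $e$ the identity of $G$. $E=\{1,\dots,N\}$ and $E^*=\bigcup_{n\ge0}E^n$ is the set of finite words. For $w=(w_1,\dots,w_n)\in E^*$, $S_w=S_{w_1}\circ\cdots\circ S_{w_n}$ and $C_w=S_w(C)$, where the self-similar set $C$ is the unique non-empty compact set with $C=\bigcup_{i\in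 E}S_i(C)$. $\mathcal{S}$ satisfies the open set condition (OSC) if there is a non-empty open set $O$ with $S_i(O)\subset O$ for all $i$ and $S_i(O)\cap S_j(O)=\emptyset$ for $i\ne j$; if furthermore $O\cap C\ne\emptyset$, then $\mathcal{S}$ satisfies the strong open set condition (for $O$). "$s$-dimensional" means that $s$ is the similarity dimension, $\sum_{i}r_i^s=1$; under the OSC in a doubling complete space, $0<\mathcal{H}^s(C)<\infty$, where $\mathcal{H}^s$ is the $s$-dimensional Hausdorff measure with respect to $d$ and $\mathcal{H}^s\lfloor C$ is its restriction to $C$. An $s$-homogeneous kernel is a function $k(x,y)=\Omega(x^{-1}\cdot y)/d(x,y)^s$, $x,y\in G$, $x\ne y$, where $\Omega:G\setminus\{e\}\to\mathbb{R}$ is continuous, not identically zero, and homogeneous of degree zero: $\Omega(\delta_r(x))=\Omega(x)$ for all $x$ and all $r>0$. For $f\in L^1(\mu)$ and $\varepsilon>0$, $T_\varepsilon(f)(x)=\int_{G\setminus B(x,\varepsilon)}k(x,y)f(y)\,d\mu(y)$, and $T^*(f)(x)=\sup_{\varepsilon>0}|T_\varepsilon(f)(x)|$. *)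

theory Defs
  imports "HOL-Analysis.Analysis"
begin

section \<open>Hausdorff measure\<close>

text \<open>
  The usual construction, with covers by arbitrary countable families. Since \<open>0 powr s = 0\<close> and
  \<open>diameter {} = 0\<close>, an empty or singleton member of a cover contributes \<open>0\<close>; this is the
  standard convention for \<open>s > 0\<close>, the only range of interest here. The library's
  \<open>diameter\<close> is meaningful only on bounded sets, so boundedness is required explicitly.
\<close>

definition hausdorff_pre :: "real \<Rightarrow> real \<Rightarrow> 'a::metric_space set \<Rightarrow> ennreal" where
  "hausdorff_pre s d X =
    (INF A\<in>{A :: nat \<Rightarrow> 'a set. X \<subseteq> (\<Union>n. A n) \<and> (\<forall>n. bounded (A n) \<and> diameter (A n) \<le> d)}.
      \<Sum>n. ennreal (diameter (A n) powr s))"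

definition hausdorff_outer :: "real \<Rightarrow> 'a::metric_space set \<Rightarrow> ennreal" where
  "hausdorff_outer s X = (SUP d\<in>{0<..}. hausdorff_pre s d X)"

text \<open>
  The Hausdorff measure on the Borel sets. The function \<open>measure_of\<close> returns the zero measure if
  its argument is not countably additive; that this does not happen is the lemma
  \<open>emeasure_hausdorff_measure\<close> below.
\<close>

definition hausdorff_measure :: "real \<Rightarrow> 'a::metric_space measure" where
  "hausdorff_measure s = measure_of UNIV (sets borel) (hausdorff_outer s)"

lemma hausdorff_pre_le:
  assumes "X \<subseteq> (\<Union>n. A n)" "\<And>n. bounded (A n)" "\<And>n. diameter (A n) \<le> d"
  shows "hausdorff_pre s d X \<le> (\<Sum>n. ennreal (diameter (A n) powr s))"
  unfolding hausdorff_pre_def by (rule INF_lower) (use assms in auto)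

lemma hausdorff_pre_mono: "X \<subseteq> Y \<Longrightarrow> hausdorff_pre s d X \<le> hausdorff_pre s d Y"
  unfolding hausdorff_pre_def by (rule INF_superset_mono) auto

lemma hausdorff_pre_antimono: "d \<le> d' \<Longrightarrow> hausdorff_pre s d' X \<le> hausdorff_pre s d X"
  unfolding hausdorff_pre_def by (rule INF_superset_mono) (auto intro: order_trans)

lemma hausdorff_pre_le_outer: "0 < d \<Longrightarrow> hausdorff_pre s d X \<le> hausdorff_outer s X"
  unfolding hausdorff_outer_def by (rule SUP_upper) auto

lemma hausdorff_pre_empty: "0 < d \<Longrightarrow> hausdorff_pre s d {} = 0"
  using hausdorff_pre_le[of "{}" "\<lambda>_. {}" d s] by simp

lemma hausdorff_pre_countably_subadditive:
  fixes X :: "nat \<Rightarrow> 'a::metric_space set"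
  shows "hausdorff_pre s d (\<Union>i. X i) \<le> (\<Sum>i. hausdorff_pre s d (X i))"
proof (rule ennreal_le_epsilon)
  fix e :: real assume e: "0 < e" and fin: "(\<Sum>i. hausdorff_pre s d (X i)) < top"
  let ?g = "\<lambda>B :: 'a set. ennreal (diameter B powr s)"
  have "\<exists>A. X i \<subseteq> (\<Union>n. A n) \<and> (\<forall>n. bounded (A n) \<and> diameter (A n) \<le> d) \<and>
    (\<Sum>n. ?g (A n)) \<le> hausdorff_pre s d (X i) + ennreal (e * (1/2) ^ Suc i)" for i
  proof -
    have "hausdorff_pre s d (X i) \<noteq> top"
      using ennreal_suminf_lessD[OF fin] by (metis less_irrefl)
    then have "hausdorff_pre s d (X i) < hausdorff_pre s d (X i) + ennreal (e * (1/2) ^ Suc i)"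
      using e ennreal_add_left_cancel_less[of "hausdorff_pre s d (X i)" 0 "ennreal (e * (1/2) ^ Suc i)"]
      by simp
    then show ?thesis
      by (subst (asm) (1) hausdorff_pre_def) (force simp: INF_less_iff intro: less_imp_le)
  qed
  then obtain A where A: "\<And>i. X i \<subseteq> (\<Union>n. A i n)"
    "\<And>i n. bounded (A i n)" "\<And>i n. diameter (A i n) \<le> d"
    "\<And>i. (\<Sum>n. ?g (A i n)) \<le> hausdorff_pre s d (X i) + ennreal (e * (1/2) ^ Suc i)"
    by metis
  define B where "B m = case_prod A (prod_decode m)" for m
  have "X i \<subseteq> (\<Union>m. B m)" for i
  proof
    fix x assume "x \<in> X i"
    then obtain n where "x \<in> A i n" using A(1) by blast
    then have "x \<in> B (prod_encode (i, n))" by (simp add: B_def)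
    then show "x \<in> (\<Union>m. B m)" by blast
  qed
  then have "hausdorff_pre s d (\<Union>i. X i) \<le> (\<Sum>m. ?g (B m))"
    by (intro hausdorff_pre_le) (auto simp: B_def A split: prod.split)
  also have "\<dots> = (\<Sum>m. (\<lambda>p. ?g (case_prod A p)) (prod_decode m))"
    by (simp add: B_def)
  also have "\<dots> = (\<Sum>i. \<Sum>n. ?g (A i n))"
    by (rule suminf_ennreal_2dimen) simp
  also have "\<dots> \<le> (\<Sum>i. hausdorff_pre s d (X i) + ennreal (e * (1/2) ^ Suc i))"
    by (intro suminf_le A(4)) auto
  also have "\<dots> = (\<Sum>i. hausdorff_pre s d (X i)) + (\<Sum>i. ennreal (e * (1/2) ^ Suc i))"
    by (rule suminf_add[symmetric]) auto
  also have "(\<Sum>i. ennreal (e * (1/2) ^ Suc i)) = ennreal e"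
    using sums_mult[OF power_half_series, of e] e
    by (intro suminf_ennreal_eq) auto
  finally show "hausdorff_pre s d (\<Union>i. X i) \<le> (\<Sum>i. hausdorff_pre s d (X i)) + ennreal e" .
qed

lemma hausdorff_outer_empty: "hausdorff_outer s {} = 0"
  by (auto simp: hausdorff_outer_def hausdorff_pre_empty)

lemma hausdorff_outer_mono: "X \<subseteq> Y \<Longrightarrow> hausdorff_outer s X \<le> hausdorff_outer s Y"
  by (auto simp: hausdorff_outer_def intro!: SUP_mono' hausdorff_pre_mono)

lemma hausdorff_outer_countably_subadditive:
  fixes X :: "nat \<Rightarrow> 'a::metric_space set"
  shows "hausdorff_outer s (\<Union>i. X i) \<le> (\<Sum>i. hausdorff_outer s (X i))"
  unfolding hausdorff_outer_def[of s "\<Union>i. X i"]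
proof (rule SUP_least)
  fix d :: real assume "d \<in> {0<..}"
  then show "hausdorff_pre s d (\<Union>i. X i) \<le> (\<Sum>i. hausdorff_outer s (X i))"
    by (intro order_trans[OF hausdorff_pre_countably_subadditive] suminf_le
          hausdorff_pre_le_outer) auto
qed

lemma hausdorff_outer_Un:
  "hausdorff_outer s (X \<union> Y) \<le> hausdorff_outer s X + hausdorff_outer s Y"
proof -
  let ?A = "\<lambda>i::nat. if i = 0 then X else if i = 1 then Y else {}"
  have "X \<union> Y \<subseteq> (\<Union>i. ?A i)"
    by (auto intro: exI[of _ 0] exI[of _ "1::nat"])
  then have "hausdorff_outer s (X \<union> Y) \<le> (\<Sum>i. hausdorff_outer s (?A i))"
    by (rule order_trans[OF hausdorff_outer_mono hausdorff_outer_countably_subadditive])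
  also have "\<dots> = (\<Sum>i\<in>{0, 1}. hausdorff_outer s (?A i))"
    by (rule suminf_finite) (auto simp: hausdorff_outer_empty)
  finally show ?thesis by simp
qed

lemma outer_measure_space_hausdorff: "outer_measure_space (Pow UNIV) (hausdorff_outer s)"
  by (auto simp: outer_measure_space_def positive_def increasing_def countably_subadditive_def
      intro: hausdorff_outer_empty hausdorff_outer_mono hausdorff_outer_countably_subadditive)

lemma hausdorff_outer_separated:
  fixes A B :: "'a::metric_space set"
  assumes "0 < e" and sep: "\<And>x y. x \<in> A \<Longrightarrow> y \<in> B \<Longrightarrow> e \<le> dist x y"
  shows "hausdorff_outer s A + hausdorff_outer s B \<le> hausdorff_outer s (A \<union> B)"
proof -
  let ?g = "\<lambda>B :: 'a set. ennreal (diameter B powr s)"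
  have small: "hausdorff_pre s d A + hausdorff_pre s d B \<le> hausdorff_pre s d (A \<union> B)"
    if d: "0 < d" "d < e" for d
    unfolding hausdorff_pre_def[of s d "A \<union> B"]
  proof (rule INF_greatest, clarify)
    fix E :: "nat \<Rightarrow> 'a set"
    assume cov: "A \<union> B \<subseteq> \<Union>(range E)" and E: "\<forall>n. bounded (E n) \<and> diameter (E n) \<le> d"
    define r where "r Z n = (if E n \<inter> Z = {} then {} else E n)" for Z n
    have le: "hausdorff_pre s d Z \<le> (\<Sum>n. ?g (r Z n))" if "Z \<subseteq> \<Union>(range E)" for Z
      using that E d by (intro hausdorff_pre_le) (auto simp: r_def, blast)
    have disj: "E n \<inter> A = {} \<or> E n \<inter> B = {}" for n
    proof (rule ccontr)
      assume "\<not> ?thesis"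
      then obtain x y where "x \<in> E n" "x \<in> A" "y \<in> E n" "y \<in> B" by blast
      then have "e \<le> d"
        using sep E diameter_bounded_bound[of "E n" x y] by (meson order_trans)
      with d show False by simp
    qed
    have "hausdorff_pre s d A + hausdorff_pre s d B \<le> (\<Sum>n. ?g (r A n)) + (\<Sum>n. ?g (r B n))"
      using cov by (intro add_mono le) auto
    also have "\<dots> = (\<Sum>n. ?g (r A n) + ?g (r B n))"
      by (rule suminf_add) auto
    also have "\<dots> \<le> (\<Sum>n. ?g (E n))"
      using disj by (intro suminf_le) (auto simp: r_def)
    finally show "hausdorff_pre s d A + hausdorff_pre s d B \<le> (\<Sum>n. ?g (E n))" .
  qed
  have "hausdorff_pre s d1 A + hausdorff_pre s d2 B \<le> hausdorff_outer s (A \<union> B)"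
    if "0 < d1" "0 < d2" for d1 d2
  proof -
    define d where "d = Min {d1, d2, e / 2}"
    have d: "0 < d" "d < e" "d \<le> d1" "d \<le> d2"
      using that \<open>0 < e\<close> by (auto simp: d_def min_def)
    have "hausdorff_pre s d1 A + hausdorff_pre s d2 B \<le> hausdorff_pre s d A + hausdorff_pre s d B"
      using d by (intro add_mono hausdorff_pre_antimono)
    also have "\<dots> \<le> hausdorff_pre s d (A \<union> B)" using d by (intro small)
    also have "\<dots> \<le> hausdorff_outer s (A \<union> B)" using d by (intro hausdorff_pre_le_outer)
    finally show ?thesis .
  qed
  then have "hausdorff_pre s d A + hausdorff_outer s B \<le> hausdorff_outer s (A \<union> B)" if "0 < d" for d
    using that unfolding hausdorff_outer_def[of s B]
    by (subst ennreal_SUP_add_right) (auto intro!: SUP_least)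
  then show ?thesis
    unfolding hausdorff_outer_def[of s A]
    by (subst ennreal_SUP_add_left[symmetric]) (auto intro!: SUP_least)
qed

lemma closed_in_lambda_system_hausdorff:
  fixes F :: "'a::metric_space set"
  assumes "closed F"
  shows "F \<in> lambda_system UNIV (Pow UNIV) (hausdorff_outer s)"
proof -
  let ?H = "hausdorff_outer s :: 'a set \<Rightarrow> ennreal"
  have "?H (X \<inter> F) + ?H (X - F) \<le> ?H X" for X
  proof (cases "F = {} \<or> ?H X = top")
    case True
    then show ?thesis by (auto simp: hausdorff_outer_empty)
  next
    case False
    then have "F \<noteq> {}" and fin: "?H X < top" by (auto simp: less_top)
    define D where "D n = {x\<in>X. 1 / real (Suc n) \<le> infdist x F}" for n
    define R where "R n = D (Suc n) - D n" for n
    have inv: "1 / real (Suc m) \<le> 1 / real (Suc n)" if "n \<le> m" for n m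
      using that by (simp add: frac_le)
    have D_sub: "D n \<subseteq> X" for n by (auto simp: D_def)
    then have R_sub: "R n \<subseteq> X" for n by (auto simp: R_def)
    have Rsep: "(\<Sum>k<n. ?H (R (2 * k + c))) \<le> ?H (\<Union>k<n. R (2 * k + c))" for n c
    proof (induction n)
      case 0 show ?case by simp
    next
      case (Suc n)
      let ?U = "\<Union>k<n. R (2 * k + c)"
      have IH: "(\<Sum>k<n. ?H (R (2 * k + c))) \<le> ?H ?U" by (fact Suc)
      define e where "e = 1 / real (2 * n + c) - 1 / real (2 * n + c + 1)"
      show ?case
      proof (cases "n = 0")
        case True then show ?thesis by (simp add: lessThan_Suc)
      next
        case n: False
        then have "0 < e" unfolding e_def diff_gt_0_iff_gt by (intro divide_strict_left_mono) auto
        have "?H ?U + ?H (R (2 * n + c)) \<le> ?H (?U \<union> R (2 * n + c))"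
        proof (rule hausdorff_outer_separated[OF \<open>0 < e\<close>])
          fix x y assume "x \<in> ?U" and y: "y \<in> R (2 * n + c)"
          then obtain k where k: "k < n" and x: "x \<in> R (2 * k + c)" by blast
          have "1 / real (2 * n + c) \<le> 1 / real (Suc (Suc (2 * k + c)))"
            using k by (intro frac_le) auto
          also have "\<dots> \<le> infdist x F" using x by (auto simp: R_def D_def)
          finally have 1: "1 / real (2 * n + c) \<le> infdist x F" .
          have 2: "infdist y F < 1 / real (2 * n + c + 1)"
            using y by (auto simp: R_def D_def not_le)
          have "infdist x F \<le> infdist y F + dist x y" by (rule infdist_triangle)
          with 1 2 show "e \<le> dist x y" unfolding e_def by linarith
        qed
        moreover have "(\<Union>k<Suc n. R (2 * k + c)) = ?U \<union> R (2 * n + c)"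
          by (auto simp: lessThan_Suc)
        ultimately show ?thesis
          using order_trans[OF add_right_mono[OF IH, of "?H (R (2 * n + c))"]] by simp
      qed
    qed
    have Rsum: "(\<Sum>k<n. ?H (R (2 * k + c))) \<le> ?H X" for n c
    proof -
      have "(\<Sum>k<n. ?H (R (2 * k + c))) \<le> ?H (\<Union>k<n. R (2 * k + c))" by (rule Rsep)
      also have "\<dots> \<le> ?H X" using R_sub by (intro hausdorff_outer_mono) auto
      finally show ?thesis .
    qed
    let ?P = "\<lambda>n. \<Sum>k<n. ?H (R k)"
    let ?S = "\<Sum>k. ?H (R k)"
    have "?P n \<le> ?H X + ?H X" for n
    proof -
      have "?P n \<le> ?P (2 * n)" by (intro sum_mono2) auto
      also have "?P (2 * n) = (\<Sum>k<n. ?H (R (2 * k + 0))) + (\<Sum>k<n. ?H (R (2 * k + 1)))"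
        by (induction n) (auto simp: algebra_simps)
      also have "\<dots> \<le> ?H X + ?H X" by (intro add_mono Rsum)
      finally show ?thesis .
    qed
    then have "?S \<le> ?H X + ?H X" by (intro suminf_le_const) auto
    with fin have S: "?S < top" by (meson ennreal_add_less_top order_le_less_trans)
    have main: "?H (X \<inter> F) + ?H (X - F) + ?P n \<le> ?H X + ?S" for n
    proof -
      have "X - F \<subseteq> D n \<union> (\<Union>k. R (k + n))"
      proof
        fix x assume x: "x \<in> X - F"
        then have "0 < infdist x F"
          using \<open>closed F\<close> \<open>F \<noteq> {}\<close> infdist_pos_not_in_closed by blast
        then obtain m where "1 / real (Suc m) < infdist x F"
          using nat_approx_posE by blast
        then have m: "x \<in> D m" using x by (simp add: D_def)
        show "x \<in> D n \<union> (\<Union>k. R (k + n))"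
        proof (cases "x \<in> D n")
          case nD: False
          define j where "j = (LEAST j. x \<in> D j)"
          have j: "x \<in> D j" unfolding j_def using m by (rule LeastI)
          have "n < j"
          proof (rule ccontr)
            assume "\<not> n < j"
            with j inv[of j n] nD show False by (force simp: D_def)
          qed
          then obtain i where i: "j = Suc i" "n \<le> i" by (cases j) auto
          have "x \<notin> D i" using not_less_Least[of i "\<lambda>j. x \<in> D j"] i(1) by (simp flip: j_def)
          with j i(1) have "x \<in> R i" by (simp add: R_def)
          then show ?thesis using i(2) by (auto intro!: exI[of _ "i - n"])
        qed simp
      qed
      then have "?H (X - F) \<le> ?H (D n \<union> (\<Union>k. R (k + n)))" by (rule hausdorff_outer_mono)
      also have "\<dots> \<le> ?H (D n) + ?H (\<Union>k. R (k + n))" by (rule hausdorff_outer_Un)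
      also have "\<dots> \<le> ?H (D n) + (\<Sum>k. ?H (R (k + n)))"
        by (intro add_left_mono hausdorff_outer_countably_subadditive)
      finally have 1: "?H (X - F) \<le> ?H (D n) + (\<Sum>k. ?H (R (k + n)))" .
      have "?H (X \<inter> F) + ?H (D n) \<le> ?H ((X \<inter> F) \<union> D n)"
      proof (rule hausdorff_outer_separated[of "1 / real (Suc n)"])
        fix x y assume "x \<in> X \<inter> F" "y \<in> D n"
        then show "1 / real (Suc n) \<le> dist x y"
          using infdist_le[of x F y] by (auto simp: D_def dist_commute)
      qed simp
      also have "\<dots> \<le> ?H X" using D_sub by (intro hausdorff_outer_mono) auto
      finally have 2: "?H (X \<inter> F) + ?H (D n) \<le> ?H X" .
      have "?H (X \<inter> F) + ?H (X - F) + ?P n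
          \<le> ?H (X \<inter> F) + (?H (D n) + (\<Sum>k. ?H (R (k + n)))) + ?P n"
        by (intro add_mono 1 order_refl)
      also have "\<dots> = (?H (X \<inter> F) + ?H (D n)) + ((\<Sum>k. ?H (R (k + n))) + ?P n)"
        by (simp add: add_ac)
      also have "(\<Sum>k. ?H (R (k + n))) + ?P n = ?S"
        by (rule suminf_offset[symmetric]) auto
      finally show ?thesis using 2 by (meson add_right_mono order_trans)
    qed
    have "?P \<longlonglongrightarrow> ?S" by (rule summable_LIMSEQ) auto
    then have "(\<lambda>n. ?H (X \<inter> F) + ?H (X - F) + ?P n) \<longlonglongrightarrow> ?H (X \<inter> F) + ?H (X - F) + ?S"
      by (intro tendsto_add tendsto_const)
    then have "?H (X \<inter> F) + ?H (X - F) + ?S \<le> ?H X + ?S"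
      using main by (intro LIMSEQ_le_const2) auto
    with S show ?thesis by (auto simp: add.commute[of _ ?S] ennreal_add_left_cancel_le)
  qed
  moreover have "?H X \<le> ?H (X \<inter> F) + ?H (X - F)" for X
    using hausdorff_outer_Un[of s "X \<inter> F" "X - F"] by (simp add: Int_Diff_Un)
  ultimately have "?H (X \<inter> F) + ?H (X - F) = ?H X" for X
    by (rule antisym)
  moreover have "F \<inter> X = X \<inter> F" "(UNIV - F) \<inter> X = X - F" for X
    by auto
  ultimately show ?thesis
    by (simp add: lambda_system_def)
qed

lemma sets_hausdorff_measure [simp, measurable_cong]: "sets (hausdorff_measure s) = sets borel"
  unfolding hausdorff_measure_def using sets.sigma_sets_eq[of borel] by simp

lemma space_hausdorff_measure [simp]: "space (hausdorff_measure s) = UNIV"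
  by (simp add: hausdorff_measure_def space_measure_of_conv)

lemma emeasure_hausdorff_measure:
  fixes X :: "'a::metric_space set"
  assumes "X \<in> sets borel"
  shows "emeasure (hausdorff_measure s) X = hausdorff_outer s X"
proof -
  let ?H = "hausdorff_outer s :: 'a set \<Rightarrow> ennreal"
  let ?L = "lambda_system UNIV (Pow UNIV) ?H"
  have ms: "measure_space UNIV ?L ?H"
    by (rule sigma_algebra.caratheodory_lemma[OF sigma_algebra_Pow outer_measure_space_hausdorff])
  then interpret L: sigma_algebra UNIV ?L by (simp add: measure_space_def)
  have "sigma_sets UNIV (Collect closed) \<subseteq> ?L"
    by (rule L.sigma_sets_subset) (blast intro: closed_in_lambda_system_hausdorff)
  then have "sets borel \<subseteq> ?L"
    by (simp add: borel_eq_closed)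
  then have "measure_space UNIV (sets borel) ?H"
    using ms sets.sigma_algebra_axioms[of borel] by (auto intro: measure_down)
  then show ?thesis
    unfolding hausdorff_measure_def using assms
    by (intro emeasure_measure_of_sigma) (auto simp: measure_space_def)
qed


section \<open>Metric groups with dilations\<close>

text \<open>
  The group is the whole type, with a topological group structure written additively: \<open>x + y\<close> is
  the group product, \<open>- x\<close> the inverse and \<open>0\<close> the identity. Neither \<open>group_add\<close> nor
  \<open>topological_group_add\<close> assumes commutativity. Nothing is assumed about \<open>\<delta> r\<close> for \<open>r \<le> 0\<close>.
\<close>

locale metric_group_with_dilations =
  fixes \<delta> :: "real \<Rightarrow> 'a::{metric_space, topological_group_add} \<Rightarrow> 'a"
  assumes dist_translation: "dist (q + x) (q + y) = dist x y"
    and continuous_dilation: "0 < r \<Longrightarrow> continuous_on UNIV (\<delta> r)"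
    and dilation_hom: "0 < r \<Longrightarrow> \<delta> r (x + y) = \<delta> r x + \<delta> r y"
    and dilation_one: "\<delta> 1 = id"
    and dist_dilation: "0 < r \<Longrightarrow> dist (\<delta> r x) (\<delta> r y) = r * dist x y"
    and dilation_mult: "0 < r \<Longrightarrow> 0 < t \<Longrightarrow> \<delta> (r * t) = \<delta> r \<circ> \<delta> t"

definition doubling_space :: "'a::metric_space itself \<Rightarrow> bool" where
  "doubling_space _ \<longleftrightarrow>
    (\<exists>M::nat. \<forall>(x::'a) r. 0 < r \<longrightarrow>
      (\<exists>Z. finite Z \<and> card Z \<le> M \<and> cball x r \<subseteq> (\<Union>z\<in>Z. cball z (r / 2))))"

text \<open>
  The value of \<open>\<Omega>\<close> at the identity and the values of \<open>k\<close> on the diagonal are left unspecified.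
\<close>

definition homogeneous_kernel ::
    "(real \<Rightarrow> 'a \<Rightarrow> 'a) \<Rightarrow> real \<Rightarrow> ('a::{metric_space, group_add} \<Rightarrow> 'a \<Rightarrow> real) \<Rightarrow> bool" where
  "homogeneous_kernel \<delta> s k \<longleftrightarrow>
    (\<exists>\<Omega>. continuous_on (- {0}) \<Omega> \<and>
         (\<exists>x. x \<noteq> 0 \<and> \<Omega> x \<noteq> 0) \<and>
         (\<forall>x r. x \<noteq> 0 \<longrightarrow> 0 < r \<longrightarrow> \<Omega> (\<delta> r x) = \<Omega> x) \<and>
         (\<forall>x y. x \<noteq> y \<longrightarrow> k x y = \<Omega> (- x + y) / dist x y powr s))"


section \<open>Iterated function systems\<close>

text \<open>
  A system \<open>S\<^sub>1, \<dots>, S\<^sub>N\<close> is given by \<open>S :: nat \<Rightarrow> 'a \<Rightarrow> 'a\<close>, of which only the values at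
  \<open>1, \<dots>, N\<close> matter; finite words over \<open>E = {1..N}\<close> are the elements of \<open>lists {1..N}\<close>.
\<close>

primrec word_map :: "(nat \<Rightarrow> 'a \<Rightarrow> 'a) \<Rightarrow> nat list \<Rightarrow> 'a \<Rightarrow> 'a" where
  "word_map S [] = id"
| "word_map S (i # w) = S i \<circ> word_map S w"

text \<open>
  For contractions of a complete space exactly one set satisfies the following predicate.
\<close>

definition self_similar_set :: "nat \<Rightarrow> (nat \<Rightarrow> 'a \<Rightarrow> 'a) \<Rightarrow> 'a::topological_space set \<Rightarrow> bool" where
  "self_similar_set N S C \<longleftrightarrow> C \<noteq> {} \<and> compact C \<and> C = (\<Union>i\<in>{1..N}. S i ` C)"

definition osc_for :: "nat \<Rightarrow> (nat \<Rightarrow> 'a \<Rightarrow> 'a) \<Rightarrow> 'a::topological_space set \<Rightarrow> bool" where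
  "osc_for N S U \<longleftrightarrow> U \<noteq> {} \<and> open U \<and> (\<forall>i\<in>{1..N}. S i ` U \<subseteq> U) \<and>
    (\<forall>i\<in>{1..N}. \<forall>j\<in>{1..N}. i \<noteq> j \<longrightarrow> S i ` U \<inter> S j ` U = {})"

definition open_set_condition :: "nat \<Rightarrow> (nat \<Rightarrow> 'a \<Rightarrow> 'a::topological_space) \<Rightarrow> bool" where
  "open_set_condition N S \<longleftrightarrow> (\<exists>U. osc_for N S U)"

definition strong_osc_for ::
    "nat \<Rightarrow> (nat \<Rightarrow> 'a \<Rightarrow> 'a) \<Rightarrow> 'a::topological_space set \<Rightarrow> 'a set \<Rightarrow> bool" where
  "strong_osc_for N S C U \<longleftrightarrow> osc_for N S U \<and> U \<inter> C \<noteq> {}"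


section \<open>Truncated and maximal singular integrals\<close>

definition truncated_integral ::
    "('a \<Rightarrow> 'a \<Rightarrow> real) \<Rightarrow> 'a::metric_space measure \<Rightarrow> real \<Rightarrow> ('a \<Rightarrow> real) \<Rightarrow> 'a \<Rightarrow> real" where
  "truncated_integral k \<mu> \<epsilon> f x = (LINT y:(- cball x \<epsilon>)|\<mu>. k x y * f y)"

definition maximal_integral ::
    "('a \<Rightarrow> 'a \<Rightarrow> real) \<Rightarrow> 'a::metric_space measure \<Rightarrow> ('a \<Rightarrow> real) \<Rightarrow> 'a \<Rightarrow> ereal" where
  "maximal_integral k \<mu> f x = (SUP \<epsilon>\<in>{0<..}. ereal \<bar>truncated_integral k \<mu> \<epsilon> f x\<bar>)"

end

theory Submission
  imports Defs
begin

text \<open>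
  Let \<open>p\<close> be the fixed point of \<open>S\<^sub>w\<close> and \<open>\<eta>\<close> the integral of \<open>k(p, \<cdot>)\<close> over \<open>C - C\<^sub>w\<close>. Homogeneity of
  the kernel cancels the scaling of the measure, so the integral over each of the layers
  \<open>S\<^sub>w\<^sup>j(C - C\<^sub>w)\<close> is also \<open>\<eta>\<close>, and the integral over \<open>C - S\<^sub>w\<^sup>n(C)\<close> is \<open>n \<eta>\<close>. By dominated convergence
  it is still nearly \<open>n \<eta>\<close> with \<open>p\<close> replaced by a point \<open>z\<close> close to \<open>p\<close>. Almost every \<open>x\<close> has the
  form \<open>S\<^sub>v z\<close> for such a \<open>z\<close> in \<open>C\<close>, and scale invariance carries the estimate over to \<open>x\<close> and
  the set \<open>C\<^sub>v - S\<^sub>v S\<^sub>w\<^sup>n(C)\<close>. Since \<open>p\<close> lies in the open set of the strong open set condition, this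
  set differs from an annulus about \<open>x\<close> by pieces on which the kernel has integral bounded
  independently of \<open>n\<close>. So a difference of two truncated integrals at \<open>x\<close> is \<open>n \<eta> + O(1)\<close>.
\<close>

section \<open>Scaling of the Hausdorff measure\<close>

lemma diameter_lipschitz_image_le:
  fixes f :: "'a::metric_space \<Rightarrow> 'b::metric_space"
  assumes "0 < c" "\<And>x y. dist (f x) (f y) \<le> c * dist x y" "bounded A"
  shows "diameter (f ` A) \<le> c * diameter A"
proof (cases "A = {}")
  case False
  have "dist (f x) (f y) \<le> c * diameter A" if "x \<in> A" "y \<in> A" for x y
    using assms(2)[of x y] mult_left_mono[OF diameter_bounded_bound[OF \<open>bounded A\<close> that], of c]
      \<open>0 < c\<close> by linarith
  with False show ?thesis
    by (auto simp: diameter_def intro!: cSUP_least)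
qed (auto simp: diameter_def)

text \<open>Mapping a cover of mesh \<open>d\<close> gives one of mesh \<open>c * d\<close> whose
  members contribute at most \<open>c powr s\<close> times as much; the change of mesh disappears in
  the supremum.\<close>

lemma hausdorff_outer_lipschitz_image_le:
  fixes f :: "'a::metric_space \<Rightarrow> 'b::metric_space"
  assumes c: "0 < c" and s: "0 \<le> s" and lip: "\<And>x y. dist (f x) (f y) \<le> c * dist x y"
  shows "hausdorff_outer s (f ` X) \<le> ennreal (c powr s) * hausdorff_outer s X"
proof -
  \<comment> \<open>The factor is divided out on the left, so that the right side is a bare infimum
    and one cover at a time can be treated.\<close>
  have pre: "hausdorff_pre s (c * d) (f ` X) / ennreal (c powr s) \<le> hausdorff_pre s d X" for d
    unfolding hausdorff_pre_def[of s d X]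
  proof (rule INF_greatest, clarify)
    fix A :: "nat \<Rightarrow> 'a set"
    assume cov: "X \<subseteq> \<Union> (range A)" and A: "\<forall>n. bounded (A n) \<and> diameter (A n) \<le> d"
    have bd: "bounded (f ` A n)" for n
    proof -
      have "bounded (A n)" using A by blast
      then obtain x e where "\<forall>y\<in>A n. dist x y \<le> e"
        unfolding bounded_def by blast
      then have "\<forall>y\<in>A n. dist (f x) (f y) \<le> c * e"
        using lip c by (meson mult_left_mono order_trans less_imp_le)
      then show ?thesis by (auto simp: bounded_def)
    qed
    have dl: "diameter (f ` A n) \<le> c * diameter (A n)" for n
      using diameter_lipschitz_image_le[OF c lip] A by blast
    have "hausdorff_pre s (c * d) (f ` X) \<le> (\<Sum>n. ennreal (diameter (f ` A n) powr s))"
    proof (rule hausdorff_pre_le)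
      show "f ` X \<subseteq> (\<Union>n. f ` A n)" using cov by blast
      show "diameter (f ` A n) \<le> c * d" for n
        using dl[of n] A c by (meson mult_left_mono order_trans less_imp_le)
    qed (rule bd)
    also have "\<dots> \<le> (\<Sum>n. ennreal (c powr s) * ennreal (diameter (A n) powr s))"
    proof (intro suminf_le)
      fix n
      have "diameter (f ` A n) powr s \<le> (c * diameter (A n)) powr s"
        using dl s bd by (intro powr_mono2) (auto intro: diameter_ge_0)
      also have "\<dots> = c powr s * diameter (A n) powr s"
        by (rule powr_mult)
      finally show "ennreal (diameter (f ` A n) powr s)
          \<le> ennreal (c powr s) * ennreal (diameter (A n) powr s)"
        by (simp flip: ennreal_mult)
    qed auto
    also have "\<dots> = ennreal (c powr s) * (\<Sum>n. ennreal (diameter (A n) powr s))"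
      by (rule ennreal_suminf_cmult)
    finally show "hausdorff_pre s (c * d) (f ` X) / ennreal (c powr s)
        \<le> (\<Sum>n. ennreal (diameter (A n) powr s))"
      using c by (subst divide_le_posI_ennreal) (auto simp: mult.commute)
  qed
  have "hausdorff_pre s d (f ` X) \<le> ennreal (c powr s) * hausdorff_outer s X" if "0 < d" for d
  proof -
    have "hausdorff_pre s d (f ` X) / ennreal (c powr s) \<le> hausdorff_pre s (d / c) X"
      using pre[of "d / c"] c by simp
    also have "\<dots> \<le> hausdorff_outer s X"
      using that c by (intro hausdorff_pre_le_outer) simp
    finally have "ennreal (c powr s) * (hausdorff_pre s d (f ` X) / ennreal (c powr s))
        \<le> ennreal (c powr s) * hausdorff_outer s X"
      by (rule mult_left_mono) simp
    then show ?thesis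
      using c by (simp add: ennreal_times_divide ennreal_mult_divide_eq mult.commute[of "ennreal _"])
  qed
  then show ?thesis
    by (auto simp: hausdorff_outer_def[of s "f ` X"] intro: SUP_least)
qed


section \<open>Similarities\<close>

context metric_group_with_dilations
begin

text \<open>The form of the maps of the iterated function system, a dilation followed by a left
  translation. Composition and inversion preserve it, so word maps have it as well.\<close>

definition similarity :: "'a \<Rightarrow> real \<Rightarrow> 'a \<Rightarrow> 'a" where
  "similarity p \<rho> x = p + \<delta> \<rho> x"

lemma dilation_zero: "0 < \<rho> \<Longrightarrow> \<delta> \<rho> 0 = 0"
  by (metis add.right_neutral add_left_cancel dilation_hom)

lemma dilation_minus: "0 < \<rho> \<Longrightarrow> \<delta> \<rho> (- x) = - \<delta> \<rho> x"
  using dilation_hom[of \<rho> "- x" x] dilation_zero[of \<rho>]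
  by (metis add.left_inverse minus_unique minus_minus)

lemma dist_similarity: "0 < \<rho> \<Longrightarrow> dist (similarity p \<rho> x) (similarity p \<rho> y) = \<rho> * dist x y"
  by (simp add: similarity_def dist_translation dist_dilation)

lemma similarity_compose:
  "0 < \<rho> \<Longrightarrow> 0 < \<rho>' \<Longrightarrow> similarity p \<rho> \<circ> similarity p' \<rho>' = similarity (p + \<delta> \<rho> p') (\<rho> * \<rho>')"
  by (auto simp: similarity_def dilation_hom dilation_mult add.assoc)

lemma inj_similarity: "0 < \<rho> \<Longrightarrow> inj (similarity p \<rho>)"
  by (metis (no_types, lifting) dist_eq_0_iff dist_similarity injI less_irrefl mult_eq_0_iff)

lemma similarity_inverse:
  assumes "0 < \<rho>"
  obtains p' where "\<And>x. similarity p' (1 / \<rho>) (similarity p \<rho> x) = x"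
    "\<And>x. similarity p \<rho> (similarity p' (1 / \<rho>) x) = x"
proof
  \<comment> \<open>Obtained by solving \<open>p + \<delta> \<rho> y = x\<close> for
    \<open>y\<close>.\<close>
  let ?p = "- \<delta> (1 / \<rho>) p"
  have d: "\<delta> (1 / \<rho>) (\<delta> \<rho> x) = x" for x
    using dilation_mult[of "1 / \<rho>" \<rho>] assms by (simp add: dilation_one fun_eq_iff)
  show 1: "similarity ?p (1 / \<rho>) (similarity p \<rho> x) = x" for x
    using assms by (simp add: similarity_def dilation_hom d flip: add.assoc)
  have d': "\<delta> \<rho> (\<delta> (1 / \<rho>) x) = x" for x
    using dilation_mult[of \<rho> "1 / \<rho>"] assms by (simp add: dilation_one fun_eq_iff)
  show "similarity p \<rho> (similarity ?p (1 / \<rho>) x) = x" for x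
    using assms by (simp add: similarity_def dilation_hom dilation_minus d' flip: add.assoc)
qed

lemma continuous_similarity: "0 < \<rho> \<Longrightarrow> continuous_on A (similarity p \<rho>)"
  unfolding similarity_def
  by (intro continuous_on_add continuous_on_const continuous_on_subset[OF continuous_dilation]) auto

text \<open>Turns images into preimages under a continuous map, from which openness and Borel
  measurability of images follow.\<close>

lemma similarity_image_eq_vimage:
  assumes "0 < \<rho>"
  obtains p' where "\<And>A. similarity p \<rho> ` A = similarity p' (1 / \<rho>) -` A"
proof -
  obtain p' where "\<And>x. similarity p' (1 / \<rho>) (similarity p \<rho> x) = x"
    "\<And>x. similarity p \<rho> (similarity p' (1 / \<rho>) x) = x"
    using similarity_inverse[OF assms, of p] by blast
  then have "similarity p \<rho> \<circ> similarity p' (1 / \<rho>) = id"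
    "similarity p' (1 / \<rho>) \<circ> similarity p \<rho> = id"
    by (simp_all add: fun_eq_iff)
  then have "bij (similarity p \<rho>)" "inv (similarity p \<rho>) = similarity p' (1 / \<rho>)"
    by (auto intro: o_bij inv_unique_comp)
  then have "similarity p \<rho> ` A = similarity p' (1 / \<rho>) -` A" for A
    using bij_vimage_eq_inv_image[OF bij_imp_bij_inv, of "similarity p \<rho>" A] inv_inv_eq
    by metis
  then show thesis by (rule that)
qed

lemma open_similarity_image:
  assumes "0 < \<rho>" "open A"
  shows "open (similarity p \<rho> ` A)"
proof -
  obtain p' where "\<And>A. similarity p \<rho> ` A = similarity p' (1 / \<rho>) -` A"
    using similarity_image_eq_vimage[OF assms(1)] by blast
  then show ?thesis
    using assms by (simp add: open_vimage continuous_similarity)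
qed

lemma borel_similarity_image:
  assumes "0 < \<rho>" "A \<in> sets borel"
  shows "similarity p \<rho> ` A \<in> sets borel"
proof -
  obtain p' where p': "\<And>A. similarity p \<rho> ` A = similarity p' (1 / \<rho>) -` A"
    using similarity_image_eq_vimage[OF assms(1)] by blast
  have "similarity p' (1 / \<rho>) \<in> borel_measurable borel"
    using assms(1) by (intro borel_measurable_continuous_onI continuous_similarity) simp
  from measurable_sets[OF this assms(2)] show ?thesis
    by (simp add: p')
qed

lemma similarity_image_cball:
  assumes "0 < \<rho>"
  shows "similarity p \<rho> ` cball x e = cball (similarity p \<rho> x) (\<rho> * e)"
proof
  show "similarity p \<rho> ` cball x e \<subseteq> cball (similarity p \<rho> x) (\<rho> * e)"
    using assms by (auto simp: dist_similarity)
  obtain p' where p': "\<And>x. similarity p \<rho> (similarity p' (1 / \<rho>) x) = x"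
    using similarity_inverse[OF assms] by blast
  show "cball (similarity p \<rho> x) (\<rho> * e) \<subseteq> similarity p \<rho> ` cball x e"
  proof
    fix y assume y: "y \<in> cball (similarity p \<rho> x) (\<rho> * e)"
    have "\<rho> * dist x (similarity p' (1 / \<rho>) y) \<le> \<rho> * e"
      using y dist_similarity[OF assms, of p x "similarity p' (1 / \<rho>) y"] by (simp add: p')
    then have "similarity p' (1 / \<rho>) y \<in> cball x e"
      using assms by simp
    then show "y \<in> similarity p \<rho> ` cball x e"
      by (metis p' imageI)
  qed
qed

text \<open>The Lipschitz estimate for the map gives one inequality, the estimate for its inverse
  the other.\<close>

lemma hausdorff_outer_similarity:
  assumes \<rho>: "0 < \<rho>" and s: "0 \<le> s"
  shows "hausdorff_outer s (similarity p \<rho> ` X) = ennreal (\<rho> powr s) * hausdorff_outer s X"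
proof (rule antisym)
  show "hausdorff_outer s (similarity p \<rho> ` X) \<le> ennreal (\<rho> powr s) * hausdorff_outer s X"
    using assms by (intro hausdorff_outer_lipschitz_image_le) (auto simp: dist_similarity)
  obtain p' where p': "\<And>x. similarity p' (1 / \<rho>) (similarity p \<rho> x) = x"
    using similarity_inverse[OF \<rho>] by blast
  have "hausdorff_outer s (similarity p' (1 / \<rho>) ` similarity p \<rho> ` X)
      \<le> ennreal ((1 / \<rho>) powr s) * hausdorff_outer s (similarity p \<rho> ` X)"
    using assms by (intro hausdorff_outer_lipschitz_image_le) (auto simp: dist_similarity)
  then have "hausdorff_outer s X
      \<le> ennreal ((1 / \<rho>) powr s) * hausdorff_outer s (similarity p \<rho> ` X)"
    by (simp add: image_image p')
  then have "ennreal (\<rho> powr s) * hausdorff_outer s X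
      \<le> ennreal (\<rho> powr s) * (ennreal ((1 / \<rho>) powr s) * hausdorff_outer s (similarity p \<rho> ` X))"
    by (rule mult_left_mono) simp
  also have "\<dots> = ennreal (\<rho> powr s * (1 / \<rho>) powr s) * hausdorff_outer s (similarity p \<rho> ` X)"
    by (simp add: ennreal_mult mult.assoc)
  also have "\<rho> powr s * (1 / \<rho>) powr s = 1"
    using \<rho> by (simp flip: powr_mult)
  finally show "ennreal (\<rho> powr s) * hausdorff_outer s X \<le> hausdorff_outer s (similarity p \<rho> ` X)"
    by simp
qed

end


section \<open>Homogeneous kernels\<close>

text \<open>Repeated halving of the radius yields finite covers by arbitrarily small balls. So a
  closed ball is totally bounded, and it is complete as a closed subset of a complete space.\<close>

lemma doubling_imp_compact_cball:
  fixes x :: "'a::complete_space"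
  assumes "doubling_space TYPE('a)"
  shows "compact (cball x R)"
proof (cases "R > 0")
  case True
  have half: "\<exists>Z. finite Z \<and> cball y t \<subseteq> (\<Union>z\<in>Z. cball z (t / 2))" if "0 < t" for y :: 'a and t
    using assms that unfolding doubling_space_def by blast
  have cover: "\<exists>Z. finite Z \<and> cball x R \<subseteq> (\<Union>z\<in>Z. cball z (R / 2 ^ n))" for n
  proof (induction n)
    case 0
    show ?case by (intro exI[of _ "{x}"]) simp
  next
    case (Suc n)
    then obtain Z where Z: "finite Z" "cball x R \<subseteq> (\<Union>z\<in>Z. cball z (R / 2 ^ n))" by blast
    define Y where "Y z = (SOME Y. finite Y \<and> cball z (R / 2 ^ n) \<subseteq> (\<Union>y\<in>Y. cball y (R / 2 ^ n / 2)))" for z :: 'a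
    have "0 < R / 2 ^ n" using True by simp
    from someI_ex[OF half[OF this]]
    have Y: "finite (Y z)" "cball z (R / 2 ^ n) \<subseteq> (\<Union>y\<in>Y z. cball y (R / 2 ^ n / 2))" for z
      unfolding Y_def by blast+
    have "R / 2 ^ n / 2 = R / 2 ^ Suc n" by simp
    then have Y': "cball z (R / 2 ^ n) \<subseteq> (\<Union>y\<in>Y z. cball y (R / 2 ^ Suc n))" for z
      using Y(2)[of z] by (simp only:)
    have "cball x R \<subseteq> (\<Union>z\<in>Z. \<Union>y\<in>Y z. cball y (R / 2 ^ Suc n))"
      by (rule order_trans[OF Z(2)]) (intro UN_mono order_refl Y')
    then have "cball x R \<subseteq> (\<Union>y\<in>(\<Union>z\<in>Z. Y z). cball y (R / 2 ^ Suc n))"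
      by (simp only: UN_UN_flatten)
    then show ?case using Z(1) Y(1) by (intro exI[of _ "\<Union>z\<in>Z. Y z"]) auto
  qed
  have "\<exists>Z. finite Z \<and> cball x R \<subseteq> (\<Union>z\<in>Z. ball z e)" if "0 < e" for e
  proof -
    obtain n where "R / e < 2 ^ n"
      using real_arch_pow[of 2 "R / e"] by auto
    then have n: "R / 2 ^ n < e" using \<open>0 < e\<close> by (simp add: field_simps)
    have "cball z (R / 2 ^ n) \<subseteq> ball z e" for z :: 'a using n by auto
    moreover obtain Z where Z: "finite Z" "cball x R \<subseteq> (\<Union>z\<in>Z. cball z (R / 2 ^ n))"
      using cover by blast
    ultimately have "cball x R \<subseteq> (\<Union>z\<in>Z. ball z e)"
      by (intro order_trans[OF Z(2)] UN_mono order_refl)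
    with Z(1) show ?thesis by (intro exI[of _ Z]) simp
  qed
  then show ?thesis
    by (auto simp: compact_eq_totally_bounded complete_eq_closed)
next
  case False
  then consider "R < 0" | "R = 0" by linarith
  then show ?thesis by cases auto
qed

context metric_group_with_dilations
begin

text \<open>\<open>\<Omega>\<close> is bounded on the unit sphere, which is compact, and homogeneity
  of degree zero extends the bound to every point other than the identity.\<close>

lemma homogeneous_kernel_bounded:
  assumes comp: "compact (cball (0::'a) 1)" and k: "homogeneous_kernel \<delta> s k"
  obtains K where "0 \<le> K" "\<And>x y. x \<noteq> y \<Longrightarrow> \<bar>k x y\<bar> \<le> K / dist x y powr s"
proof -
  obtain \<Omega> where \<Omega>: "continuous_on (- {0}) \<Omega>"
    "\<And>x r. x \<noteq> 0 \<Longrightarrow> 0 < r \<Longrightarrow> \<Omega> (\<delta> r x) = \<Omega> x"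
    "\<And>x y. x \<noteq> y \<Longrightarrow> k x y = \<Omega> (- x + y) / dist x y powr s"
    using k unfolding homogeneous_kernel_def by blast
  have "closed {x::'a. dist 0 x = 1}"
    by (intro closed_Collect_eq continuous_intros)
  then have "compact (cball 0 1 \<inter> {x::'a. dist 0 x = 1})"
    by (rule compact_Int_closed[OF comp])
  moreover have "cball 0 1 \<inter> {x::'a. dist 0 x = 1} = {x. dist 0 x = 1}" by auto
  ultimately have "compact {x::'a. dist 0 x = 1}" by simp
  moreover have "continuous_on {x. dist 0 x = 1} \<Omega>"
    by (rule continuous_on_subset[OF \<Omega>(1)]) auto
  ultimately have "bounded (\<Omega> ` {x. dist 0 x = 1})"
    by (intro compact_imp_bounded compact_continuous_image)
  then obtain K where K: "\<And>x. dist 0 x = 1 \<Longrightarrow> \<bar>\<Omega> x\<bar> \<le> K"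
    by (auto simp: bounded_iff)
  have le: "\<bar>\<Omega> x\<bar> \<le> K" if "x \<noteq> 0" for x
  proof -
    have pos: "0 < 1 / dist 0 x" using that by simp
    have "dist 0 (\<delta> (1 / dist 0 x) x) = 1"
      using dist_dilation[OF pos, of 0 x] dilation_zero[OF pos] that by simp
    then show ?thesis using K \<Omega>(2)[OF that pos] by metis
  qed
  show thesis
  proof
    \<comment> \<open>\<open>max\<close> secures the sign of the constant without exhibiting a point
      of the sphere.\<close>
    show "0 \<le> max K 0" by simp
    fix x y :: 'a assume "x \<noteq> y"
    then have "- x + y \<noteq> 0" by (metis add.right_neutral add_minus_cancel)
    then have "\<bar>\<Omega> (- x + y)\<bar> \<le> max K 0" using le by (simp add: le_max_iff_disj)
    then show "\<bar>k x y\<bar> \<le> max K 0 / dist x y powr s"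
      unfolding \<Omega>(3)[OF \<open>x \<noteq> y\<close>] by (simp add: abs_divide divide_right_mono)
  qed
qed

text \<open>The translation cancels in \<open>- x + y\<close> and \<open>\<Omega>\<close> does not
  see the dilation, so only the distance in the denominator scales.\<close>

lemma homogeneous_kernel_similarity:
  assumes k: "homogeneous_kernel \<delta> s k" and "0 < \<rho>" "x \<noteq> y"
  shows "k (similarity p \<rho> x) (similarity p \<rho> y) = k x y / \<rho> powr s"
proof -
  obtain \<Omega> where \<Omega>: "\<And>x r. x \<noteq> 0 \<Longrightarrow> 0 < r \<Longrightarrow> \<Omega> (\<delta> r x) = \<Omega> x"
    "\<And>x y. x \<noteq> y \<Longrightarrow> k x y = \<Omega> (- x + y) / dist x y powr s"
    using k unfolding homogeneous_kernel_def by blast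
  have "- similarity p \<rho> x + similarity p \<rho> y = \<delta> \<rho> (- x + y)"
    unfolding similarity_def dilation_hom[OF \<open>0 < \<rho>\<close>] dilation_minus[OF \<open>0 < \<rho>\<close>]
    by (metis add.assoc minus_add minus_add_cancel)
  moreover have "- x + y \<noteq> 0" by (metis \<open>x \<noteq> y\<close> add.right_neutral add_minus_cancel)
  moreover have "similarity p \<rho> x \<noteq> similarity p \<rho> y"
    using inj_similarity[OF \<open>0 < \<rho>\<close>] \<open>x \<noteq> y\<close> by (simp add: inj_eq)
  ultimately show ?thesis
    using assms by (simp add: \<Omega> dist_similarity powr_mult)
qed

lemma tendsto_homogeneous_kernel:
  assumes k: "homogeneous_kernel \<delta> s k" and "(f \<longlongrightarrow> x) F" "(g \<longlongrightarrow> y) F" "x \<noteq> y"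
  shows "((\<lambda>n. k (f n) (g n)) \<longlongrightarrow> k x y) F"
proof -
  obtain \<Omega> where \<Omega>: "continuous_on (- {0}) \<Omega>"
    "\<And>x y. x \<noteq> y \<Longrightarrow> k x y = \<Omega> (- x + y) / dist x y powr s"
    using k unfolding homogeneous_kernel_def by blast
  have ne: "- x + y \<noteq> 0" by (metis \<open>x \<noteq> y\<close> add.right_neutral add_minus_cancel)
  have lim: "((\<lambda>n. - f n + g n) \<longlongrightarrow> - x + y) F"
    by (intro tendsto_intros assms)
  have "isCont \<Omega> (- x + y)"
    using \<Omega>(1) ne continuous_on_eq_continuous_at[of "- {0}" \<Omega>] by auto
  then have "((\<lambda>n. \<Omega> (- f n + g n)) \<longlongrightarrow> \<Omega> (- x + y)) F"
    using lim by (rule isCont_tendsto_compose)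
  then have "((\<lambda>n. \<Omega> (- f n + g n) / dist (f n) (g n) powr s) \<longlongrightarrow> k x y) F"
    unfolding \<Omega>(2)[OF \<open>x \<noteq> y\<close>] using \<open>x \<noteq> y\<close> by (intro tendsto_intros assms) auto
  moreover
  \<comment> \<open>On the diagonal \<open>k\<close> is unspecified, so its formula through
    \<open>\<Omega>\<close> is available only where \<open>f\<close> and \<open>g\<close>
    differ.\<close>
  have "\<forall>\<^sub>F n in F. f n \<noteq> g n"
  proof -
    have "\<forall>\<^sub>F n in F. dist (f n) (g n) \<noteq> 0"
      by (rule tendsto_imp_eventually_ne[OF tendsto_dist[OF assms(2,3)]]) (use \<open>x \<noteq> y\<close> in simp)
    then show ?thesis by (rule eventually_mono) simp
  qed
  then have "\<forall>\<^sub>F n in F. \<Omega> (- f n + g n) / dist (f n) (g n) powr s = k (f n) (g n)"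
    by (rule eventually_mono) (simp add: \<Omega>(2))
  ultimately show ?thesis
    by (rule Lim_transform_eventually)
qed

lemma set_borel_measurable_homogeneous_kernel:
  assumes k: "homogeneous_kernel \<delta> s k" and "A \<in> sets borel" "x \<notin> A"
  shows "(\<lambda>y. indicator A y *\<^sub>R k x y) \<in> borel_measurable borel"
proof (rule borel_measurable_continuous_on_indicator[OF assms(2)])
  show "continuous_on A (k x)"
    unfolding continuous_on_def
    using \<open>x \<notin> A\<close> by (intro ballI tendsto_homogeneous_kernel[OF k] tendsto_const tendsto_ident_at) auto
qed

end


section \<open>Self-similar sets\<close>

lemma word_map_append: "word_map S (u @ v) = word_map S u \<circ> word_map S v"
  by (induction u) (auto simp: o_assoc)

locale dilation_ifs = metric_group_with_dilations \<delta>
  for \<delta> :: "real \<Rightarrow> 'a::{metric_space, topological_group_add} \<Rightarrow> 'a" +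
  fixes S :: "nat \<Rightarrow> 'a \<Rightarrow> 'a" and q :: "nat \<Rightarrow> 'a" and r :: "nat \<Rightarrow> real"
    and N :: nat and C :: "'a set"
  assumes ratio: "i \<in> {1..N} \<Longrightarrow> 0 < r i \<and> r i < 1"
    and map_eq: "i \<in> {1..N} \<Longrightarrow> S i = (\<lambda>x. q i + \<delta> (r i) x)"
    and self_similar: "self_similar_set N S C"
begin

section \<open>Words and the maps they define\<close>

abbreviation words :: "nat list set" where
  "words \<equiv> lists {1..N}"

definition word_ratio :: "nat list \<Rightarrow> real" where
  "word_ratio w = prod_list (map r w)"

lemma word_ratio_Nil [simp]: "word_ratio [] = 1"
  and word_ratio_Cons [simp]: "word_ratio (i # w) = r i * word_ratio w"
  and word_ratio_append [simp]: "word_ratio (u @ v) = word_ratio u * word_ratio v"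
  by (simp_all add: word_ratio_def)

lemma word_ratio_pos: "w \<in> words \<Longrightarrow> 0 < word_ratio w"
  by (induction w) (auto simp: ratio)

lemma word_ratio_less_one: "w \<in> words \<Longrightarrow> w \<noteq> [] \<Longrightarrow> word_ratio w < 1"
proof (induction w)
  case (Cons i w)
  then have i: "0 < r i" "r i < 1" and w: "w \<in> words" using ratio by auto
  have "word_ratio w \<le> 1" using Cons.IH[OF w] by (cases "w = []") auto
  then have "r i * word_ratio w \<le> r i" using i by (simp add: mult_left_le)
  with i(2) show ?case unfolding word_ratio_Cons by linarith
qed simp

lemma word_ratio_power: "word_ratio (concat (replicate n w)) = word_ratio w ^ n"
  by (induction n) auto

lemma word_power_in_words: "w \<in> words \<Longrightarrow> concat (replicate n w) \<in> words"
  by (induction n) auto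

lemma word_map_power_fixed: "word_map S w p = p \<Longrightarrow> word_map S (concat (replicate n w)) p = p"
  by (induction n) (auto simp: word_map_append)

lemma map_similarity: "i \<in> {1..N} \<Longrightarrow> S i = similarity (q i) (r i)"
  by (auto simp: map_eq similarity_def)

lemma word_map_similarity:
  assumes "w \<in> words"
  obtains p where "word_map S w = similarity p (word_ratio w)"
proof -
  have "\<exists>p. word_map S w = similarity p (word_ratio w)"
    using assms
  proof (induction w)
    case Nil
    show ?case by (auto simp: similarity_def dilation_one intro!: exI[of _ 0])
  next
    case (Cons i w)
    then obtain p where "word_map S w = similarity p (word_ratio w)" by auto
    with Cons.hyps show ?case
      by (auto simp: map_similarity similarity_compose ratio word_ratio_pos)
  qed
  then show thesis using that by blast
qed

lemma inj_word_map: "w \<in> words \<Longrightarrow> inj (word_map S w)"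
  by (metis word_map_similarity inj_similarity word_ratio_pos)

lemma dist_word_map:
  "w \<in> words \<Longrightarrow> dist (word_map S w x) (word_map S w y) = word_ratio w * dist x y"
  by (metis word_map_similarity dist_similarity word_ratio_pos)

lemma continuous_word_map: "w \<in> words \<Longrightarrow> continuous_on A (word_map S w)"
  by (metis word_map_similarity continuous_similarity word_ratio_pos)

lemma word_map_image_cball:
  "w \<in> words \<Longrightarrow> word_map S w ` cball x e = cball (word_map S w x) (word_ratio w * e)"
  by (metis word_map_similarity similarity_image_cball word_ratio_pos)

lemma borel_word_map_image:
  "w \<in> words \<Longrightarrow> A \<in> sets borel \<Longrightarrow> word_map S w ` A \<in> sets borel"
  by (metis word_map_similarity borel_similarity_image word_ratio_pos)

lemma borel_measurable_word_map [measurable]: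
  "w \<in> words \<Longrightarrow> word_map S w \<in> borel_measurable borel"
  by (intro borel_measurable_continuous_onI continuous_word_map)

section \<open>Invariance of \<open>C\<close> and the open set condition\<close>

lemma C_nonempty: "C \<noteq> {}" and compact_C: "compact C" and C_eq: "C = (\<Union>i\<in>{1..N}. S i ` C)"
  using self_similar by (auto simp: self_similar_set_def)

lemma borel_C [measurable]: "C \<in> sets borel"
  by (intro borel_closed compact_imp_closed compact_C)

lemma map_image_subset: "i \<in> {1..N} \<Longrightarrow> S i ` C \<subseteq> C"
  using C_eq by blast

lemma word_map_image_subset:
  assumes "w \<in> words"
  shows "word_map S w ` C \<subseteq> C"
  using assms
proof (induction w)
  case (Cons i w)
  then have "word_map S (i # w) ` C \<subseteq> S i ` C"
    by (auto simp flip: image_image)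
  then show ?case using map_image_subset[of i] Cons.hyps by blast
qed simp

text \<open>Since \<open>S i\<close> maps \<open>U\<close> into itself, it shrinks the distance to
  \<open>U\<close> by the factor \<open>r i\<close>. A point of \<open>C\<close> at maximal distance
  is \<open>S i z\<close> with \<open>z\<close> in \<open>C\<close>, so its distance is at most
  \<open>r i\<close> times itself and must vanish.\<close>

lemma self_similar_subset_closure:
  assumes "osc_for N S U"
  shows "C \<subseteq> closure U"
proof -
  have U: "U \<noteq> {}" "\<And>i. i \<in> {1..N} \<Longrightarrow> S i ` U \<subseteq> U"
    using assms by (auto simp: osc_for_def)
  have scale: "infdist (S i y) U \<le> r i * infdist y U" if i: "i \<in> {1..N}" for i y
  proof -
    have "infdist (S i y) U / r i \<le> dist y u" if "u \<in> U" for u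
    proof -
      have "infdist (S i y) U \<le> dist (S i y) (S i u)"
        using U(2)[OF i] that by (intro infdist_le) auto
      then show ?thesis
        using ratio[OF i] by (simp add: map_similarity[OF i] dist_similarity field_simps)
    qed
    then have "infdist (S i y) U / r i \<le> infdist y U"
      using U(1) by (auto simp: infdist_notempty intro!: cINF_greatest)
    then show ?thesis using ratio[OF i] by (simp add: field_simps)
  qed
  have "continuous_on C (\<lambda>y. infdist y U)"
    by (intro continuous_intros)
  then obtain y where y: "y \<in> C" "\<And>x. x \<in> C \<Longrightarrow> infdist x U \<le> infdist y U"
    using continuous_attains_sup[OF compact_C C_nonempty] by blast
  obtain i z where iz: "i \<in> {1..N}" "z \<in> C" "y = S i z"
    using y(1) C_eq by blast
  have "infdist y U \<le> r i * infdist y U"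
    using scale[OF iz(1), of z] mult_left_mono[OF y(2)[OF iz(2)], of "r i"] ratio[OF iz(1)]
    unfolding iz(3) by linarith
  then have "infdist y U \<le> 0"
    using ratio[OF iz(1)] by (simp add: mult_le_cancel_right1)
  then have "infdist x U = 0" if "x \<in> C" for x
    using y(2)[OF that] infdist_nonneg[of x U] by linarith
  then show ?thesis
    using in_closure_iff_infdist_zero[OF U(1)] by blast
qed

text \<open>An open set disjoint from \<open>S\<^sub>j U\<close> also misses its closure, which
  contains \<open>S\<^sub>j C\<close>. So a point of \<open>C\<close> in \<open>S\<^sub>i U\<close>
  can only come from \<open>S\<^sub>i C\<close>; this fixes the first letter, and induction does the
  rest.\<close>

lemma osc_cylinder:
  assumes osc: "osc_for N S U" and "v \<in> words"
  shows "C \<inter> word_map S v ` U \<subseteq> word_map S v ` C"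
  using \<open>v \<in> words\<close>
proof (induction v)
  case (Cons i v)
  have i: "i \<in> {1..N}" and v: "v \<in> words" using Cons.hyps by auto
  \<comment> \<open>Puts points of \<open>S\<^sub>i S\<^sub>v U\<close> into
    \<open>S\<^sub>i U\<close>, where disjointness applies.\<close>
  have vU: "word_map S v ` U \<subseteq> U"
    using v
  proof (induction v)
    case (Cons j v)
    then have "S j ` word_map S v ` U \<subseteq> S j ` U" "S j ` U \<subseteq> U"
      using osc by (auto simp: osc_for_def)
    then show ?case by (simp add: image_comp)
  qed simp
  show ?case
  proof
    fix y assume y: "y \<in> C \<inter> word_map S (i # v) ` U"
    then obtain u where u: "u \<in> U" "y = S i (word_map S v u)" by auto
    obtain j c where j: "j \<in> {1..N}" and c: "c \<in> C" "y = S j c"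
      using y C_eq by blast
    have yi: "y \<in> S i ` U" using u vU by blast
    have "i = j"
    proof (rule ccontr)
      assume "i \<noteq> j"
      have "open (S i ` U)"
        using osc ratio[OF i] by (simp add: map_similarity[OF i] open_similarity_image osc_for_def)
      moreover have "y \<in> closure (S j ` U)"
      proof -
        have "continuous_on (closure U) (S j)"
          using ratio[OF j] by (simp add: map_similarity[OF j] continuous_similarity)
        then have "S j ` closure U \<subseteq> closure (S j ` U)"
          by (rule image_closure_subset) (auto intro: closure_subset[THEN subsetD])
        then show ?thesis using c self_similar_subset_closure[OF osc] by blast
      qed
      ultimately have "S i ` U \<inter> S j ` U \<noteq> {}"
        using yi open_Int_closure_eq_empty[of "S i ` U" "S j ` U"] by blast
      then show False using osc i j \<open>i \<noteq> j\<close> by (auto simp: osc_for_def)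
    qed
    then have "c = word_map S v u"
      using c(2) u(2) inj_similarity[of "r i" "q i"] ratio[OF i]
      by (metis injD map_similarity[OF i])
    then have "c \<in> word_map S v ` C"
      using Cons.IH c(1) u(1) by blast
    then show "y \<in> word_map S (i # v) ` C"
      using c(2) \<open>i = j\<close> by auto
  qed
qed simp

text \<open>The form in which the open set condition is used: the rest of \<open>C\<close> keeps a
  distance from \<open>S\<^sub>v z\<close> proportional to the ratio of \<open>v\<close>.\<close>

lemma osc_cball_subset_cylinder:
  assumes "osc_for N S U" "v \<in> words" "cball z e \<subseteq> U"
  shows "C \<inter> cball (word_map S v z) (word_ratio v * e) \<subseteq> word_map S v ` C"
  using osc_cylinder[OF assms(1,2)] assms(3) word_map_image_cball[OF assms(2), of z e] by blast

end


section \<open>Self-similar measures\<close>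

text \<open>The properties through which the normalised Hausdorff measure enters. Scaling is
  restricted to subsets of \<open>C\<close>, since a null set off \<open>C\<close> may have an image
  that meets \<open>C\<close>.\<close>

locale self_similar_measure = dilation_ifs +
  fixes \<mu> :: "'a measure" and s :: real
  assumes sets_\<mu> [measurable_cong, simp]: "sets \<mu> = sets borel"
    and finite_\<mu>: "finite_measure \<mu>"
    and null_\<mu>: "emeasure \<mu> (- C) = 0"
    and scaling_\<mu>: "i \<in> {1..N} \<Longrightarrow> A \<in> sets borel \<Longrightarrow> A \<subseteq> C \<Longrightarrow>
      emeasure \<mu> (S i ` A) = ennreal (r i powr s) * emeasure \<mu> A"
    and ratio_sum: "(\<Sum>i\<in>{1..N}. r i powr s) = 1"
begin

sublocale finite_measure \<mu> by (rule finite_\<mu>)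

lemma space_\<mu> [simp]: "space \<mu> = UNIV"
  using sets_eq_imp_space_eq[OF sets_\<mu>] by simp

lemma AE_in_C: "AE x in \<mu>. x \<in> C"
  by (rule AE_I[OF _ null_\<mu>]) auto

lemma emeasure_word_map_image:
  assumes "w \<in> words" "A \<in> sets borel" "A \<subseteq> C"
  shows "emeasure \<mu> (word_map S w ` A) = ennreal (word_ratio w powr s) * emeasure \<mu> A"
  using assms(1)
proof (induction w)
  case (Cons i w)
  have "word_map S w ` A \<subseteq> C"
    using word_map_image_subset[of w] Cons.hyps assms(3) by blast
  then have "emeasure \<mu> (S i ` word_map S w ` A)
      = ennreal (r i powr s) * emeasure \<mu> (word_map S w ` A)"
    using Cons.hyps assms(2) by (intro scaling_\<mu> borel_word_map_image) auto
  also have "\<dots> = ennreal (r i powr s) * (ennreal (word_ratio w powr s) * emeasure \<mu> A)"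
    by (simp add: Cons.IH)
  finally show ?case
    by (simp add: image_comp powr_mult ennreal_mult mult.assoc)
qed simp

lemma measure_word_map_image:
  assumes "w \<in> words" "A \<in> sets borel" "A \<subseteq> C"
  shows "measure \<mu> (word_map S w ` A) = word_ratio w powr s * measure \<mu> A"
  using emeasure_word_map_image[OF assms] by (simp add: measure_def enn2real_mult)

text \<open>A change of variables: on the image of \<open>A\<close>, the measure is
  \<open>word_ratio w powr s\<close> times the pushforward of its restriction to
  \<open>A\<close>.\<close>

lemma set_integral_word_map_image:
  fixes f :: "'a \<Rightarrow> real"
  assumes w: "w \<in> words" and A: "A \<in> sets borel" "A \<subseteq> C"
    and f: "(\<lambda>y. indicator (word_map S w ` A) y *\<^sub>R f y) \<in> borel_measurable borel"
  shows "(LINT y:word_map S w ` A|\<mu>. f y)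
    = word_ratio w powr s * (LINT y:A|\<mu>. f (word_map S w y))"
proof -
  let ?W = "word_map S w"
  \<comment> \<open>Only the product with the indicator is known to be measurable, so
    \<open>g\<close> replaces \<open>f\<close> in the computation.\<close>
  define g where "g y = indicator (?W ` A) y *\<^sub>R f y" for y
  let ?c = "word_ratio w powr s"
  note [measurable] = A(1) borel_word_map_image[OF w A(1)] borel_measurable_word_map[OF w]
  have eq: "density \<mu> (\<lambda>y. ennreal (indicator (?W ` A) y))
      = density (distr (density \<mu> (\<lambda>y. ennreal (indicator A y))) borel ?W) (\<lambda>_. ennreal ?c)"
    (is "?M1 = ?M2")
  proof (rule measure_eqI)
    fix B assume "B \<in> sets ?M1"
    then have [measurable]: "B \<in> sets borel" by simp
    have vm [measurable]: "?W -` B \<in> sets borel"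
      using measurable_sets[OF borel_measurable_word_map[OF w] \<open>B \<in> sets borel\<close>] by simp
    have im: "?W ` (A \<inter> ?W -` B) = ?W ` A \<inter> B" by auto
    have "emeasure ?M1 B = emeasure \<mu> (?W ` A \<inter> B)"
      by (simp add: emeasure_density ennreal_indicator flip: indicator_inter_arith)
    also have "\<dots> = ennreal ?c * emeasure \<mu> (A \<inter> ?W -` B)"
      unfolding im[symmetric] using A by (intro emeasure_word_map_image[OF w]) auto
    also have "emeasure \<mu> (A \<inter> ?W -` B) = emeasure (density \<mu> (\<lambda>y. ennreal (indicator A y))) (?W -` B)"
      by (simp add: emeasure_density ennreal_indicator flip: indicator_inter_arith)
    also have "\<dots> = emeasure (distr (density \<mu> (\<lambda>y. ennreal (indicator A y))) borel ?W) B"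
      by (simp add: emeasure_distr)
    also have "ennreal ?c * \<dots> = emeasure ?M2 B"
      by (simp add: emeasure_density nn_integral_cmult_indicator)
    finally show "emeasure ?M1 B = emeasure ?M2 B" .
  qed simp
  have gm [measurable]: "g \<in> borel_measurable borel"
    using f unfolding g_def .
  have "(LINT y:?W ` A|\<mu>. f y) = (LINT y|\<mu>. indicator (?W ` A) y *\<^sub>R g y)"
    unfolding set_lebesgue_integral_def
    by (intro Bochner_Integration.integral_cong) (auto simp: g_def indicator_def)
  also have "\<dots> = integral\<^sup>L ?M1 g"
    by (intro integral_density[symmetric]) auto
  also have "\<dots> = integral\<^sup>L ?M2 g"
    by (simp only: eq)
  also have "\<dots> = (LINT y|distr (density \<mu> (\<lambda>y. ennreal (indicator A y))) borel ?W. ?c *\<^sub>R g y)"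
    by (intro integral_density) auto
  also have "\<dots> = (LINT y|density \<mu> (\<lambda>y. ennreal (indicator A y)). ?c *\<^sub>R g (?W y))"
    by (intro integral_distr) auto
  also have "\<dots> = (LINT y|\<mu>. indicator A y *\<^sub>R (?c *\<^sub>R g (?W y)))"
    by (intro integral_density) auto
  also have "\<dots> = (LINT y|\<mu>. ?c * (indicator A y *\<^sub>R f (?W y)))"
    by (intro Bochner_Integration.integral_cong) (auto simp: g_def indicator_def)
  also have "\<dots> = ?c * (LINT y:A|\<mu>. f (?W y))"
    unfolding set_lebesgue_integral_def by simp
  finally show ?thesis .
qed

text \<open>
  The set \<open>D\<close> of points outside all \<open>C\<^bsub>vu\<^esub>\<close> satisfies \<open>D \<subseteq> (\<Union>i. S\<^sub>i D)\<close> while \<open>D\<close> misses \<open>S\<^sub>u D\<close>;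
  iterating the inclusion along \<open>u\<close> gives \<open>\<mu> D \<le> (1 - r\<^sub>u\<^sup>s) \<mu> D\<close>.
\<close>

lemma AE_visits_cylinder:
  assumes u: "u \<in> words"
  shows "AE x in \<mu>. \<exists>v\<in>words. x \<in> word_map S (v @ u) ` C"
proof -
  define D where "D = C - (\<Union>v\<in>words. word_map S (v @ u) ` C)"
  have "countable words" by simp
  then have [measurable]: "D \<in> sets borel"
    unfolding D_def using u
    by (intro sets.Diff borel_C sets.countable_UN' image_subsetI borel_word_map_image)
      simp_all
  have DC: "D \<subseteq> C" by (auto simp: D_def)
  have D_sub: "D \<subseteq> (\<Union>i\<in>{1..N}. S i ` D)"
  proof
    fix x assume x: "x \<in> D"
    then obtain i y where i: "i \<in> {1..N}" "y \<in> C" "x = S i y"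
      using C_eq DC by blast
    have "y \<notin> word_map S (v @ u) ` C" if "v \<in> words" for v
    proof
      assume "y \<in> word_map S (v @ u) ` C"
      then have "x \<in> word_map S ((i # v) @ u) ` C"
        using i(3) by auto
      moreover have "i # v \<in> words" using i(1) that by simp
      ultimately show False using x unfolding D_def by blast
    qed
    then have "y \<in> D" using i(2) unfolding D_def by blast
    then show "x \<in> (\<Union>i\<in>{1..N}. S i ` D)" using i by blast
  qed
  have le: "measure \<mu> (D - word_map S v ` D) \<le> (1 - word_ratio v powr s) * measure \<mu> D"
    if "v \<in> words" for v
    using that
  proof (induction v)
    case (Cons i v)
    have i: "i \<in> {1..N}" and v: "v \<in> words" using Cons.hyps by auto
    have Si: "S j ` A = word_map S [j] ` A" for j A by simp
    have Sm [measurable]: "S j ` A \<in> sets borel" if "j \<in> {1..N}" "A \<in> sets borel" for j A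
      unfolding Si using that by (intro borel_word_map_image) auto
    have [measurable]: "word_map S v ` D \<in> sets borel"
      using v by (intro borel_word_map_image) auto
    have mS: "measure \<mu> (S j ` A) = r j powr s * measure \<mu> A"
      if "j \<in> {1..N}" "A \<in> sets borel" "A \<subseteq> C" for j A
      using measure_word_map_image[of "[j]" A] that by simp
    let ?J = "{1..N} - {i}"
    have inj: "S i ` (D - word_map S v ` D) = S i ` D - S i ` word_map S v ` D"
      using inj_similarity[of "r i" "q i"] ratio[OF i]
      by (intro image_set_diff) (simp add: map_similarity[OF i])
    \<comment> \<open>Of the pieces \<open>S\<^sub>j D\<close> covering \<open>D\<close>, only
      \<open>j = i\<close> is refined. The others have total measure at most
      \<open>1 - r i powr s\<close> times that of \<open>D\<close>; subadditivity absorbs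
      overlaps.\<close>
    have sub: "D - word_map S (i # v) ` D \<subseteq> (\<Union>j\<in>?J. S j ` D) \<union> S i ` (D - word_map S v ` D)"
      unfolding inj
    proof
      fix x assume x: "x \<in> D - word_map S (i # v) ` D"
      then obtain j y where "j \<in> {1..N}" "y \<in> D" "x = S j y" using D_sub by blast
      then show "x \<in> (\<Union>j\<in>?J. S j ` D) \<union> (S i ` D - S i ` word_map S v ` D)"
        using x by (cases "j = i") (auto simp: image_comp)
    qed
    have "measure \<mu> (D - word_map S (i # v) ` D)
        \<le> measure \<mu> ((\<Union>j\<in>?J. S j ` D) \<union> S i ` (D - word_map S v ` D))"
      using i by (intro finite_measure_mono sub) (auto intro!: sets.Un sets.finite_UN Sm)
    also have "\<dots> \<le> measure \<mu> (\<Union>j\<in>?J. S j ` D) + measure \<mu> (S i ` (D - word_map S v ` D))"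
      using i by (intro measure_Un_le) (auto intro!: sets.finite_UN Sm)
    also have "\<dots> \<le> (\<Sum>j\<in>?J. measure \<mu> (S j ` D)) + measure \<mu> (S i ` (D - word_map S v ` D))"
      by (intro add_right_mono finite_measure_subadditive_finite) (auto intro!: Sm)
    also have "(\<Sum>j\<in>?J. measure \<mu> (S j ` D)) = (\<Sum>j\<in>?J. r j powr s) * measure \<mu> D"
      unfolding sum_distrib_right using DC by (intro sum.cong) (auto intro!: mS)
    also have "(\<Sum>j\<in>?J. r j powr s) = 1 - r i powr s"
      using ratio_sum i by (simp add: sum_diff1)
    also have "measure \<mu> (S i ` (D - word_map S v ` D))
        = r i powr s * measure \<mu> (D - word_map S v ` D)"
      using DC i by (intro mS) auto
    finally have "measure \<mu> (D - word_map S (i # v) ` D)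
        \<le> (1 - r i powr s) * measure \<mu> D + r i powr s * measure \<mu> (D - word_map S v ` D)" .
    also have "\<dots> \<le> (1 - r i powr s) * measure \<mu> D
        + r i powr s * ((1 - word_ratio v powr s) * measure \<mu> D)"
      by (intro add_left_mono mult_left_mono Cons.IH) simp
    also have "\<dots> = (1 - word_ratio (i # v) powr s) * measure \<mu> D"
      by (simp add: powr_mult algebra_simps)
    finally show ?case .
  qed simp
  have "D - word_map S u ` D = D"
  proof -
    \<comment> \<open>The empty \<open>v\<close> in the definition of \<open>D\<close> excludes
      \<open>C\<^sub>u\<close>, which contains \<open>S\<^sub>u D\<close>.\<close>
    have "[] \<in> words" by simp
    then have "D \<inter> word_map S ([] @ u) ` C = {}" unfolding D_def by blast
    then show ?thesis using DC by auto
  qed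
  then have "measure \<mu> D \<le> (1 - word_ratio u powr s) * measure \<mu> D"
    using le[OF u] by simp
  moreover have "0 < word_ratio u powr s"
    using word_ratio_pos[OF u] by simp
  ultimately have "measure \<mu> D = 0"
    using measure_nonneg[of \<mu> D] by (auto simp: algebra_simps mult_le_0_iff)
  then have "emeasure \<mu> D = 0"
    by (simp add: emeasure_eq_measure)
  then have "AE x in \<mu>. x \<notin> D"
    by (intro AE_not_in) (auto simp: null_sets_def)
  then show ?thesis
    using AE_in_C by eventually_elim (auto simp: D_def)
qed

end


section \<open>Singular integrals on self-similar sets\<close>

locale self_similar_singular_integral = self_similar_measure +
  fixes k :: "'a \<Rightarrow> 'a \<Rightarrow> real" and K :: real
  assumes s_nonneg: "0 \<le> s"
    and kernel: "homogeneous_kernel \<delta> s k"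
    and K_nonneg: "0 \<le> K"
    and kernel_bound: "x \<noteq> y \<Longrightarrow> \<bar>k x y\<bar> \<le> K / dist x y powr s"
begin

section \<open>Kernel integrals at positive distance and their scale invariance\<close>

lemma kernel_le:
  assumes "0 < c" "c \<le> dist x y"
  shows "\<bar>k x y\<bar> \<le> K / c powr s"
proof -
  have "\<bar>k x y\<bar> \<le> K / dist x y powr s" using assms by (intro kernel_bound) auto
  also have "\<dots> \<le> K / c powr s"
    using assms s_nonneg K_nonneg by (intro frac_le powr_mono2) auto
  finally show ?thesis .
qed

lemma set_integrable_kernel:
  assumes "A \<in> sets borel" "0 < c" "\<And>y. y \<in> A \<Longrightarrow> c \<le> dist x y"
  shows "set_integrable \<mu> A (k x)"
  unfolding set_integrable_def
proof (rule integrable_const_bound)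
  have "x \<notin> A" using assms(2,3) by force
  then show "(\<lambda>y. indicator A y *\<^sub>R k x y) \<in> borel_measurable \<mu>"
    using set_borel_measurable_homogeneous_kernel[OF kernel assms(1)]
    by (simp add: measurable_cong_sets[OF sets_\<mu> refl])
  show "AE y in \<mu>. norm (indicator A y *\<^sub>R k x y) \<le> K / c powr s"
    using assms(2,3) K_nonneg by (auto simp: indicator_def intro!: kernel_le)
qed

lemma set_integral_kernel_le:
  assumes "A \<in> sets borel" "0 < c" "\<And>y. y \<in> A \<Longrightarrow> c \<le> dist x y"
  shows "\<bar>LINT y:A|\<mu>. k x y\<bar> \<le> K / c powr s * measure \<mu> A"
proof -
  have "\<bar>LINT y:A|\<mu>. k x y\<bar> \<le> (LINT y|\<mu>. norm (indicator A y *\<^sub>R k x y))"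
    unfolding set_lebesgue_integral_def
    using integral_norm_bound[of \<mu> "\<lambda>y. indicator A y *\<^sub>R k x y"] by simp
  also have "\<dots> \<le> (LINT y|\<mu>. K / c powr s * indicator A y)"
  proof (rule integral_mono)
    show "integrable \<mu> (\<lambda>y. norm (indicator A y *\<^sub>R k x y))"
      using set_integrable_kernel[OF assms] unfolding set_integrable_def by (rule integrable_norm)
    show "integrable \<mu> (\<lambda>y. K / c powr s * indicator A y)"
      using assms(1) by (intro integrable_mult_right integrable_real_indicator)
        (auto simp: emeasure_eq_measure)
    show "norm (indicator A y *\<^sub>R k x y) \<le> K / c powr s * indicator A y" for y
      using assms(2,3) by (auto simp: indicator_def intro!: kernel_le)
  qed
  also have "\<dots> = K / c powr s * measure \<mu> A"
    using assms(1) by simp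
  finally show ?thesis .
qed

text \<open>The substitution contributes \<open>word_ratio v powr s\<close> and the kernel its
  reciprocal: the exponents of measure and kernel match.\<close>

lemma set_integral_kernel_cylinder:
  assumes v: "v \<in> words" and A: "A \<in> sets borel" "A \<subseteq> C" and "z \<notin> A"
  shows "(LINT y:word_map S v ` A|\<mu>. k (word_map S v z) y) = (LINT y:A|\<mu>. k z y)"
proof -
  have pos: "0 < word_ratio v" by (rule word_ratio_pos[OF v])
  obtain p where p: "word_map S v = similarity p (word_ratio v)"
    using word_map_similarity[OF v] by blast
  have "word_map S v z \<notin> word_map S v ` A"
    using inj_word_map[OF v] \<open>z \<notin> A\<close> by (simp add: inj_image_mem_iff)
  then have "(LINT y:word_map S v ` A|\<mu>. k (word_map S v z) y)
      = word_ratio v powr s * (LINT y:A|\<mu>. k (word_map S v z) (word_map S v y))"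
    by (intro set_integral_word_map_image v A set_borel_measurable_homogeneous_kernel[OF kernel]
        borel_word_map_image)
  also have "(LINT y:A|\<mu>. k (word_map S v z) (word_map S v y))
      = (LINT y:A|\<mu>. k z y / word_ratio v powr s)"
  proof (rule set_lebesgue_integral_cong, safe)
    fix y assume "y \<in> A"
    then have "z \<noteq> y" using \<open>z \<notin> A\<close> by blast
    then show "k (word_map S v z) (word_map S v y) = k z y / word_ratio v powr s"
      unfolding p by (rule homogeneous_kernel_similarity[OF kernel pos])
  qed (use A in simp)
  finally show ?thesis using pos by simp
qed

text \<open>\<open>C\<close> carries the measure; \<open>0 \<le> \<epsilon>\<close> puts
  \<open>x\<close> into the ball and so outside both domains of integration.\<close>

lemma truncated_integral_eq:
  assumes "0 \<le> \<epsilon>"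
  shows "truncated_integral k \<mu> \<epsilon> (\<lambda>_. 1) x = (LINT y:C - cball x \<epsilon>|\<mu>. k x y)"
proof -
  have meas: "(\<lambda>y. indicator A y *\<^sub>R k x y) \<in> borel_measurable \<mu>"
    if "A \<in> sets borel" "x \<notin> A" for A
    using set_borel_measurable_homogeneous_kernel[OF kernel that]
    by (simp add: measurable_cong_sets[OF sets_\<mu> refl])
  have "(LINT y:- cball x \<epsilon>|\<mu>. k x y) = (LINT y:C - cball x \<epsilon>|\<mu>. k x y)"
  proof (rule set_integral_cong_set)
    show "AE y in \<mu>. (y \<in> C - cball x \<epsilon>) = (y \<in> - cball x \<epsilon>)"
      using AE_in_C by eventually_elim auto
  qed (use assms in \<open>auto simp: set_borel_measurable_def simp del: real_scaleR_def intro!: meas\<close>)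
  then show ?thesis by (simp add: truncated_integral_def)
qed

text \<open>
  A point \<open>x\<close> with \<open>cball (S\<^sub>v\<^sup>-\<^sup>1 x) \<rho> \<subseteq> U\<close> sees only \<open>C\<^sub>v\<close> within distance \<open>\<rho> r\<^sub>v\<close>, and on the part
  of \<open>C\<^sub>v\<close> beyond that distance the kernel is at most \<open>K / (\<rho> r\<^sub>v)\<^sup>s\<close> while \<open>\<mu> C\<^sub>v = r\<^sub>v\<^sup>s \<mu> C\<close>. So
  balls may be replaced by cylinders at a cost independent of the scale.
\<close>

lemma truncated_integral_difference:
  assumes osc: "osc_for N S U" and u: "u \<in> words" and v: "v \<in> words" and \<rho>: "0 < \<rho>"
    and U1: "cball (word_map S u z) \<rho> \<subseteq> U" and U2: "cball z \<rho> \<subseteq> U"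
  defines "x \<equiv> word_map S (v @ u) z"
  shows "\<bar>truncated_integral k \<mu> (word_ratio (v @ u) * \<rho>) (\<lambda>_. 1) x
      - truncated_integral k \<mu> (word_ratio v * \<rho>) (\<lambda>_. 1) x
      - (LINT y:C - word_map S u ` C|\<mu>. k (word_map S u z) y)\<bar>
    \<le> 2 * (K / \<rho> powr s * measure \<mu> C)"
proof -
  let ?C = "\<lambda>w. word_map S w ` C" and ?B = "\<lambda>w. cball x (word_ratio w * \<rho>)"
  have vu: "v @ u \<in> words" using u v by simp
  note pos = word_ratio_pos[OF u] word_ratio_pos[OF v] word_ratio_pos[OF vu]
  have x: "x = word_map S v (word_map S u z)" by (simp add: x_def word_map_append)
  have nest: "?C (v @ u) = word_map S v ` ?C u"
    by (simp add: word_map_append image_comp)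
  have sub: "?C (v @ u) \<subseteq> ?C v" "?C v \<subseteq> C"
    unfolding nest using word_map_image_subset u v by blast+
  have Bv: "C \<inter> ?B v \<subseteq> ?C v"
    unfolding x by (rule osc_cball_subset_cylinder[OF osc v U1])
  have Bvu: "C \<inter> ?B (v @ u) \<subseteq> ?C (v @ u)"
    unfolding x_def by (rule osc_cball_subset_cylinder[OF osc vu U2])
  have Bu: "C \<inter> cball (word_map S u z) (word_ratio u * \<rho>) \<subseteq> ?C u"
    by (rule osc_cball_subset_cylinder[OF osc u U2])
  have borel: "?C w \<in> sets borel" if "w \<in> words" for w
    using that by (intro borel_word_map_image) auto
  have borels [measurable]: "?C v \<in> sets borel" "?C u \<in> sets borel" "?C (v @ u) \<in> sets borel"
    by (intro borel u v vu)+
  have int_v: "set_integrable \<mu> A (k x)" if "A \<in> sets borel" "A \<inter> ?B v = {}" for A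
    using that \<rho> pos by (intro set_integrable_kernel[of _ "word_ratio v * \<rho>"]) force+
  have int_vu: "set_integrable \<mu> A (k x)" if "A \<in> sets borel" "A \<inter> ?B (v @ u) = {}" for A
    using that \<rho> pos by (intro set_integrable_kernel[of _ "word_ratio (v @ u) * \<rho>"]) force+
  have disj: "(C - ?C v) \<inter> ?B v = {}" "(C - ?C v) \<inter> ?B (v @ u) = {}"
    "(?C v - ?C (v @ u)) \<inter> ?B (v @ u) = {}"
    using Bv Bvu sub by blast+
  have "C - ?B v = (C - ?C v) \<union> (?C v - ?B v)"
    using Bv sub by blast
  then have Tv: "truncated_integral k \<mu> (word_ratio v * \<rho>) (\<lambda>_. 1) x
      = (LINT y:C - ?C v|\<mu>. k x y) + (LINT y:?C v - ?B v|\<mu>. k x y)"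
    using \<rho> pos disj by (simp add: truncated_integral_eq) (intro set_integral_Un int_v; auto)
  \<comment> \<open>From outside in: beyond \<open>C\<^sub>v\<close>, between the two cylinders, and
    the inner cylinder beyond its ball. The first piece also occurs in \<open>Tv\<close> and
    cancels; the second gives the main term.\<close>
  have split2: "C - ?B (v @ u) = (C - ?C v) \<union> ((?C v - ?C (v @ u)) \<union> (?C (v @ u) - ?B (v @ u)))"
    using Bvu sub by blast
  have Tvu: "truncated_integral k \<mu> (word_ratio (v @ u) * \<rho>) (\<lambda>_. 1) x
      = (LINT y:C - ?C v|\<mu>. k x y) + ((LINT y:?C v - ?C (v @ u)|\<mu>. k x y)
        + (LINT y:?C (v @ u) - ?B (v @ u)|\<mu>. k x y))"
  proof -
    have i: "set_integrable \<mu> (C - ?C v) (k x)" "set_integrable \<mu> (?C v - ?C (v @ u)) (k x)"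
      "set_integrable \<mu> (?C (v @ u) - ?B (v @ u)) (k x)"
      using disj by (auto intro!: int_vu simp del: word_ratio_append)
    have "truncated_integral k \<mu> (word_ratio (v @ u) * \<rho>) (\<lambda>_. 1) x = (LINT y:C - ?B (v @ u)|\<mu>. k x y)"
      using pos \<rho> by (intro truncated_integral_eq) simp
    also have "\<dots> = (LINT y:C - ?C v|\<mu>. k x y)
        + (LINT y:(?C v - ?C (v @ u)) \<union> (?C (v @ u) - ?B (v @ u))|\<mu>. k x y)"
      unfolding split2 using sub by (intro set_integral_Un i set_integrable_Un) auto
    also have "(LINT y:(?C v - ?C (v @ u)) \<union> (?C (v @ u) - ?B (v @ u))|\<mu>. k x y)
        = (LINT y:?C v - ?C (v @ u)|\<mu>. k x y) + (LINT y:?C (v @ u) - ?B (v @ u)|\<mu>. k x y)"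
      by (intro set_integral_Un i) auto
    finally show ?thesis .
  qed
  have "?C v - ?C (v @ u) = word_map S v ` (C - ?C u)"
    unfolding nest by (rule image_set_diff[OF inj_word_map[OF v], symmetric])
  \<comment> \<open>\<open>z\<close> is not assumed to lie in \<open>C\<close>; but if
    \<open>S\<^sub>u z\<close> does, it is the centre of the ball in \<open>Bu\<close> and hence in
    \<open>C\<^sub>u\<close>.\<close>
  moreover have "word_map S u z \<notin> C - ?C u"
    using Bu \<rho> pos by auto
  ultimately have main: "(LINT y:?C v - ?C (v @ u)|\<mu>. k x y)
      = (LINT y:C - ?C u|\<mu>. k (word_map S u z) y)"
    unfolding x by (simp only:) (intro set_integral_kernel_cylinder v; auto)
  \<comment> \<open>Used for \<open>v\<close> and for \<open>v @ u\<close>, which explains the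
    factor \<open>2\<close> in the bound.\<close>
  have err: "\<bar>LINT y:?C w - ?B w|\<mu>. k x y\<bar> \<le> K / \<rho> powr s * measure \<mu> C" if w: "w \<in> words" for w
  proof -
    note [measurable] = borel[OF w]
    have "\<bar>LINT y:?C w - ?B w|\<mu>. k x y\<bar>
        \<le> K / (word_ratio w * \<rho>) powr s * measure \<mu> (?C w - ?B w)"
      using \<rho> word_ratio_pos[OF w] by (intro set_integral_kernel_le) auto
    also have "\<dots> \<le> K / (word_ratio w * \<rho>) powr s * measure \<mu> (?C w)"
      using K_nonneg by (intro mult_left_mono finite_measure_mono) auto
    also have "\<dots> = K / \<rho> powr s * measure \<mu> C"
      using word_ratio_pos[OF w] by (simp add: measure_word_map_image[OF w] powr_mult)
    finally show ?thesis .
  qed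
  show ?thesis
    unfolding Tv Tvu main using err[OF v] err[OF vu] by linarith
qed

text \<open>Once \<open>X n\<close> is within \<open>c / 2\<close> of \<open>p\<close>, it keeps
  distance \<open>c / 2\<close> from \<open>A\<close>. So after finitely many terms the integrands
  have a constant majorant, and dominated convergence applies.\<close>

lemma tendsto_set_integral_kernel:
  assumes A: "A \<in> sets borel" and c: "0 < c" "\<And>y. y \<in> A \<Longrightarrow> c \<le> dist p y" and X: "X \<longlonglongrightarrow> p"
  shows "(\<lambda>n. LINT y:A|\<mu>. k (X n) y) \<longlonglongrightarrow> (LINT y:A|\<mu>. k p y)"
proof -
  obtain n0 where n0: "\<And>n. n0 \<le> n \<Longrightarrow> dist (X n) p < c / 2"
    using X c(1) by (meson half_gt_zero metric_LIMSEQ_D)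
  have far: "c / 2 \<le> dist (X n) y" if "n0 \<le> n" "y \<in> A" for n y
    using n0[OF that(1)] c(2)[OF that(2)] dist_triangle[of p y "X n"] by (simp add: dist_commute)
  have int: "set_integrable \<mu> A (k (X (n + n0)))" for n
    using c(1) far[of "n + n0"] by (intro set_integrable_kernel[OF A, of "c / 2"]) auto
  have "(\<lambda>n. LINT y:A|\<mu>. k (X (n + n0)) y) \<longlonglongrightarrow> (LINT y:A|\<mu>. k p y)"
    unfolding set_lebesgue_integral_def
  proof (rule integral_dominated_convergence)
    show "(\<lambda>y. indicator A y *\<^sub>R k p y) \<in> borel_measurable \<mu>"
      using set_integrable_kernel[OF A c] unfolding set_integrable_def by (rule borel_measurable_integrable)
    show "(\<lambda>y. indicator A y *\<^sub>R k (X (n + n0)) y) \<in> borel_measurable \<mu>" for n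
      using int unfolding set_integrable_def by (rule borel_measurable_integrable)
    show "integrable \<mu> (\<lambda>_. K / (c / 2) powr s)" by simp
    show "AE y in \<mu>. norm (indicator A y *\<^sub>R k (X (n + n0)) y) \<le> K / (c / 2) powr s" for n
      using c(1) K_nonneg far[of "n + n0"] by (auto simp: indicator_def intro!: kernel_le)
    have "(\<lambda>n. indicator A y *\<^sub>R k (X (n + n0)) y) \<longlonglongrightarrow> indicator A y *\<^sub>R k p y" for y
    proof (cases "y \<in> A")
      case True
      then have "p \<noteq> y" using c by force
      with X show ?thesis
        by (intro tendsto_scaleR tendsto_const tendsto_homogeneous_kernel[OF kernel] LIMSEQ_ignore_initial_segment)
    qed simp
    then show "AE y in \<mu>. (\<lambda>n. indicator A y *\<^sub>R k (X (n + n0)) y) \<longlonglongrightarrow> indicator A y *\<^sub>R k p y"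
      by simp
  qed
  then show ?thesis by (rule LIMSEQ_offset)
qed

text \<open>\<open>S\<^sub>w\<close> fixes \<open>p\<close> and maps \<open>C\<close> minus the
  cylinder of the \<open>n\<close>-th power of \<open>w\<close> onto \<open>C\<^sub>w\<close> minus
  that of the next power. Scale invariance keeps the integral, and the layer
  \<open>C - C\<^sub>w\<close> adds one more summand.\<close>

lemma set_integral_kernel_power:
  assumes osc: "osc_for N S U" and w: "w \<in> words" and p: "word_map S w p = p"
    and \<rho>: "0 < \<rho>" "cball p \<rho> \<subseteq> U"
  shows "(LINT y:C - word_map S (concat (replicate n w)) ` C|\<mu>. k p y)
    = real n * (LINT y:C - word_map S w ` C|\<mu>. k p y)"
proof (induction n)
  case 0
  show ?case by (simp add: set_lebesgue_integral_def)
next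
  case (Suc n)
  let ?u = "concat (replicate n w)" and ?u' = "concat (replicate (Suc n) w)"
  let ?C = "\<lambda>w. word_map S w ` C"
  note wn = word_power_in_words[OF w] word_map_power_fixed[OF p]
  \<comment> \<open>As \<open>S\<^sub>v\<close> fixes \<open>p\<close>, it maps the ball in
    \<open>U\<close> to a smaller ball about \<open>p\<close>, which meets \<open>C\<close> only in
    \<open>C\<^sub>v\<close>.\<close>
  have far: "word_ratio v * \<rho> \<le> dist p y" "0 < word_ratio v * \<rho>"
    if "v \<in> words" "word_map S v p = p" "y \<in> C - ?C v" for v y
    using osc_cball_subset_cylinder[OF osc that(1) \<rho>(2)] that word_ratio_pos[OF that(1)] \<rho>(1)
    by force+
  have int: "set_integrable \<mu> (C - ?C v) (k p)" if "v \<in> words" "word_map S v p = p" for v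
    using far[OF that] word_ratio_pos[OF that(1)] \<rho>(1) borel_word_map_image[OF that(1) borel_C]
    by (intro set_integrable_kernel[of _ "word_ratio v * \<rho>"]) auto
  have diff: "word_map S w ` (C - ?C ?u) = ?C w - ?C ?u'"
    by (simp add: image_set_diff[OF inj_word_map[OF w]] word_map_append image_comp)
  have sub: "?C ?u' \<subseteq> ?C w" "?C w \<subseteq> C"
    using word_map_image_subset[OF w] word_map_image_subset[OF wn(1), of n]
    by (auto simp: word_map_append)
  have "p \<notin> C - ?C ?u"
    using far[of ?u p] wn by force
  then have "(LINT y:word_map S w ` (C - ?C ?u)|\<mu>. k (word_map S w p) y) = (LINT y:C - ?C ?u|\<mu>. k p y)"
    using borel_word_map_image[OF wn(1) borel_C] by (intro set_integral_kernel_cylinder w) auto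
  then have step: "(LINT y:?C w - ?C ?u'|\<mu>. k p y) = (LINT y:C - ?C ?u|\<mu>. k p y)"
    unfolding diff p .
  have "C - ?C ?u' = (C - ?C w) \<union> (?C w - ?C ?u')"
    using sub by blast
  moreover have "set_integrable \<mu> (?C w - ?C ?u') (k p)"
    using int[OF wn[of "Suc n"]] by (rule set_integrable_subset)
      (use sub borel_word_map_image[OF w borel_C] borel_word_map_image[OF wn(1) borel_C, of "Suc n"] in auto)
  ultimately have "(LINT y:C - ?C ?u'|\<mu>. k p y)
      = (LINT y:C - ?C w|\<mu>. k p y) + (LINT y:?C w - ?C ?u'|\<mu>. k p y)"
    using int[OF w p] by (simp only:) (intro set_integral_Un; auto)
  then show ?case
    unfolding step Suc.IH by (simp add: algebra_simps)
qed

lemma maximal_integral_infinite: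
  assumes osc: "osc_for N S U" and w: "w \<in> words" and p: "word_map S w p = p" "p \<in> U"
    and nz: "(LINT y:C - word_map S w ` C|\<mu>. k p y) \<noteq> 0"
  shows "AE x in \<mu>. maximal_integral k \<mu> (\<lambda>_. 1) x = \<infinity>"
proof -
  define \<eta> where "\<eta> = (LINT y:C - word_map S w ` C|\<mu>. k p y)"
  have "open U" using osc by (simp add: osc_for_def)
  then obtain \<rho>' where "0 < \<rho>'" "cball p \<rho>' \<subseteq> U"
    using p(2) open_contains_cball by blast
  \<comment> \<open>Halving leaves room in \<open>U\<close> for balls of radius
    \<open>\<rho>\<close> about all points within \<open>\<rho>\<close> of \<open>p\<close>.\<close>
  define \<rho> where "\<rho> = \<rho>' / 2"
  have \<rho>: "0 < \<rho>" "cball p (2 * \<rho>) \<subseteq> U"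
    using \<open>0 < \<rho>'\<close> \<open>cball p \<rho>' \<subseteq> U\<close> by (simp_all add: \<rho>_def)
  have near: "cball z \<rho> \<subseteq> U" if "dist p z \<le> \<rho>" for z
  proof
    fix y assume "y \<in> cball z \<rho>"
    then have "y \<in> cball p (2 * \<rho>)"
      using that dist_triangle[of p y z] by simp
    then show "y \<in> U" using \<rho>(2) by blast
  qed
  then have p\<rho>: "cball p \<rho> \<subseteq> U" using \<rho>(1) by simp
  define B where "B = 2 * (K / \<rho> powr s * measure \<mu> C)"
  \<comment> \<open>For the empty word the domain of integration is empty and the integral
    zero.\<close>
  have "w \<noteq> []" using nz by (auto simp: set_lebesgue_integral_def)
  then have w1: "word_ratio w < 1" by (rule word_ratio_less_one[OF w])
  \<comment> \<open>\<open>1\<close> is the error of moving \<open>p\<close> to a nearby point,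
    \<open>B\<close> that of trading balls for cylinders. One of two truncated integrals must have
    at least half the size of their difference.\<close>
  have step: "AE x in \<mu>. ereal ((real n * \<bar>\<eta>\<bar> - 1 - B) / 2) \<le> maximal_integral k \<mu> (\<lambda>_. 1) x" for n
  proof -
    let ?u = "concat (replicate n w)"
    let ?I = "\<lambda>z. LINT y:C - word_map S ?u ` C|\<mu>. k z y"
    have u: "?u \<in> words" and up: "word_map S ?u p = p"
      by (intro word_power_in_words w word_map_power_fixed p)+
    note upos = word_ratio_pos[OF u]
    have far: "word_ratio ?u * \<rho> \<le> dist p y" if "y \<in> C - word_map S ?u ` C" for y
      using osc_cball_subset_cylinder[OF osc u p\<rho>] that unfolding up by force
    have "(?I \<longlongrightarrow> ?I p) (at p)"
      unfolding tendsto_at_iff_sequentially comp_def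
    proof (intro allI impI tendsto_set_integral_kernel[of _ "word_ratio ?u * \<rho>"])
      show "C - word_map S ?u ` C \<in> sets borel"
        using borel_word_map_image[OF u borel_C] by auto
    qed (use upos \<rho>(1) far in auto)
    then have "\<forall>\<^sub>F z in at p. dist (?I z) (?I p) < 1"
      by (rule tendstoD) simp
    then obtain d' where d': "0 < d'" "\<And>z. z \<noteq> p \<Longrightarrow> dist z p < d' \<Longrightarrow> dist (?I z) (?I p) < 1"
      by (auto simp: eventually_at)
    \<comment> \<open>For a point \<open>z\<close> within \<open>d\<close> of \<open>p\<close>, the
      three bounds give in turn: \<open>?I z\<close> is within \<open>1\<close> of
      \<open>?I p\<close>, the ball of radius \<open>\<rho>\<close> about \<open>z\<close> lies in
      \<open>U\<close>, and \<open>z\<close> is the image under \<open>S\<^sub>u\<close> of a point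
      within \<open>\<rho>\<close> of \<open>p\<close>.\<close>
    define d where "d = Min {d', \<rho>, word_ratio ?u * \<rho>}"
    have d: "0 < d" "d \<le> d'" "d \<le> \<rho>" "d \<le> word_ratio ?u * \<rho>"
      using d'(1) \<rho>(1) upos by (auto simp: d_def)
    obtain e' where e': "\<And>c. c \<in> C \<Longrightarrow> dist p c \<le> e'"
      using compact_imp_bounded[OF compact_C] bounded_any_center by blast
    define e where "e = max e' 1"
    have e: "0 < e" "\<And>c. c \<in> C \<Longrightarrow> dist c p \<le> e"
      using e' by (auto simp: e_def dist_commute le_max_iff_disj)
    \<comment> \<open>Enough repetitions of \<open>w\<close> bring the whole cylinder within
      \<open>d\<close> of \<open>p\<close>; almost every \<open>x\<close> lies in a copy of that
      cylinder.\<close>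
    obtain m where m: "word_ratio w ^ m < d / e"
      using real_arch_pow_inv[of "d / e" "word_ratio w"] d(1) e(1) w1 by auto
    let ?v = "concat (replicate m w)"
    have v: "?v \<in> words" and vp: "word_map S ?v p = p"
      by (intro word_power_in_words w word_map_power_fixed p)+
    have close: "dist (word_map S ?v c) p < d" if "c \<in> C" for c
    proof -
      have "dist (word_map S ?v c) p = word_ratio w ^ m * dist c p"
        using dist_word_map[OF v, of c p] by (simp add: vp word_ratio_power)
      also have "\<dots> \<le> word_ratio w ^ m * e"
        using e(2)[OF that] word_ratio_pos[OF w] by (intro mult_left_mono) auto
      also have "\<dots> < d" using m e(1) by (simp add: field_simps)
      finally show ?thesis .
    qed
    show ?thesis
      using AE_visits_cylinder[OF v]
    proof eventually_elim
      case (elim x)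
      then obtain v' c where v': "v' \<in> words" and c: "c \<in> C" "x = word_map S (v' @ ?v) c" by blast
      define z where "z = word_map S ?v c"
      have z: "dist z p < d" unfolding z_def by (rule close[OF c(1)])
      then have "z \<in> cball (word_map S ?u p) (word_ratio ?u * \<rho>)"
        using d(4) by (simp add: up dist_commute)
      then obtain z' where z': "z' \<in> cball p \<rho>" "z = word_map S ?u z'"
        unfolding word_map_image_cball[OF u, symmetric] by blast
      \<comment> \<open>The suffix \<open>?v\<close> only served to bring \<open>z\<close> close to
        \<open>p\<close>; it is exchanged for \<open>?u\<close>, whose cylinder is the one removed
        in \<open>?I\<close>.\<close>
      have x: "x = word_map S (v' @ ?u) z'"
        using c(2) z'(2) by (simp add: word_map_append z_def)
      have "dist (?I z) (?I p) < 1"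
        using d'(2)[of z] z d(2) by (cases "z = p") auto
      then have I: "\<bar>?I z - real n * \<eta>\<bar> < 1"
        using set_integral_kernel_power[OF osc w p(1) \<rho>(1) p\<rho>, of n] by (simp add: dist_real_def \<eta>_def)
      let ?T = "\<lambda>\<epsilon>. truncated_integral k \<mu> \<epsilon> (\<lambda>_. 1) x"
      let ?e1 = "word_ratio v' * \<rho>" and ?e2 = "word_ratio (v' @ ?u) * \<rho>"
      have T: "\<bar>?T ?e2 - ?T ?e1 - ?I z\<bar> \<le> B"
        unfolding x z'(2) B_def
        using z d(3) z'(1)
        by (intro truncated_integral_difference[OF osc u v' \<rho>(1) near near]) (auto simp: z'(2) dist_commute)
      \<comment> \<open>Here \<open>a\<close> and \<open>b\<close> stand for the truncated integrals
        at \<open>?e2\<close> and \<open>?e1\<close>, \<open>c\<close> for \<open>?I z\<close> and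
        \<open>m\<close> for \<open>real n * \<eta>\<close>.\<close>
      have "(\<bar>m\<bar> - 1 - B) / 2 \<le> \<bar>b\<bar> \<or> (\<bar>m\<bar> - 1 - B) / 2 \<le> \<bar>a\<bar>"
        if "\<bar>a - b - c\<bar> \<le> B" "\<bar>c - m\<bar> < 1" for a b c m
      proof (rule disjCI)
        have "\<bar>m\<bar> \<le> \<bar>a\<bar> + \<bar>b\<bar> + B + 1" using that by linarith
        moreover assume "\<not> (\<bar>m\<bar> - 1 - B) / 2 \<le> \<bar>a\<bar>"
        ultimately show "(\<bar>m\<bar> - 1 - B) / 2 \<le> \<bar>b\<bar>" by (simp add: field_simps)
      qed
      from this[OF T I]
      have "(real n * \<bar>\<eta>\<bar> - 1 - B) / 2 \<le> \<bar>?T ?e1\<bar> \<or> (real n * \<bar>\<eta>\<bar> - 1 - B) / 2 \<le> \<bar>?T ?e2\<bar>"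
        unfolding abs_mult abs_of_nat .
      moreover have "ereal \<bar>?T \<epsilon>\<bar> \<le> maximal_integral k \<mu> (\<lambda>_. 1) x" if "0 < \<epsilon>" for \<epsilon>
        unfolding maximal_integral_def using that by (intro SUP_upper) auto
      moreover have "0 < ?e1" "0 < ?e2"
        using word_ratio_pos[OF v'] upos \<rho>(1) by auto
      ultimately show ?case
        by (meson ereal_less_eq(3) order_trans)
    qed
  qed
  \<comment> \<open>The exceptional null set depends on \<open>n\<close>; countably many are
    united.\<close>
  have "AE x in \<mu>. \<forall>n. ereal ((real n * \<bar>\<eta>\<bar> - 1 - B) / 2) \<le> maximal_integral k \<mu> (\<lambda>_. 1) x"
    using step by (simp add: AE_all_countable)
  then show ?thesis
  proof eventually_elim
    case (elim x)
    show ?case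
    proof (rule ereal_top)
      fix b :: real
      have "0 < \<bar>\<eta>\<bar>" using nz by (simp add: \<eta>_def)
      obtain n where "(2 * b + 1 + B) / \<bar>\<eta>\<bar> \<le> real n"
        using real_arch_simple by blast
      then have "b \<le> (real n * \<bar>\<eta>\<bar> - 1 - B) / 2"
        using \<open>0 < \<bar>\<eta>\<bar>\<close> by (simp add: field_simps)
      then show "ereal b \<le> maximal_integral k \<mu> (\<lambda>_. 1) x"
        using elim by (meson ereal_less_eq(3) order_trans)
    qed
  qed
qed

end

section \<open>Application to the normalised Hausdorff measure\<close>

theorem theorem4p1:
  fixes \<delta> :: "real \<Rightarrow> 'a::{complete_space, topological_group_add} \<Rightarrow> 'a"
    and S :: "nat \<Rightarrow> 'a \<Rightarrow> 'a" and q :: "nat \<Rightarrow> 'a" and r :: "nat \<Rightarrow> real"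
    and N :: nat and s :: real and C :: "'a set" and \<mu> :: "'a measure"
    and k :: "'a \<Rightarrow> 'a \<Rightarrow> real"
  assumes "metric_group_with_dilations \<delta>"
    and "doubling_space TYPE('a)"
    and "2 \<le> N"
    and "\<And>i. i \<in> {1..N} \<Longrightarrow> 0 < r i \<and> r i < 1"
    and "\<And>i. i \<in> {1..N} \<Longrightarrow> S i = (\<lambda>x. q i + \<delta> (r i) x)"
    and "open_set_condition N S"
    and "self_similar_set N S C"
    and "(\<Sum>i\<in>{1..N}. r i powr s) = 1"
    and "\<mu> = uniform_measure (hausdorff_measure s) C"
    and "homogeneous_kernel \<delta> s k"
    and "\<exists>w\<in>lists {1..N}. \<exists>x\<in>C. word_map S w x = x \<and>
           (\<exists>U. strong_osc_for N S C U \<and> x \<in> U) \<and>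
           (LINT y:(C - word_map S w ` C)|\<mu>. k x y) \<noteq> 0"
  shows "AE x in \<mu>. maximal_integral k \<mu> (\<lambda>_. 1) x = \<infinity>"
proof -
  interpret dilation_ifs \<delta> S q r N C
    using assms by (intro dilation_ifs.intro dilation_ifs_axioms.intro) auto
  \<comment> \<open>For negative \<open>s\<close> every summand \<open>r i powr s\<close> is at
    least \<open>1\<close>, so the sum is at least \<open>N\<close>, which exceeds
    \<open>1\<close>.\<close>
  have s: "0 \<le> s"
  proof (rule ccontr)
    assume "\<not> 0 \<le> s"
    then have "1 \<le> r i powr s" if "i \<in> {1..N}" for i
      using ratio[OF that] powr_mono'[of s 0 "r i"] by simp
    then have "(\<Sum>i\<in>{1..N}. 1) \<le> (\<Sum>i\<in>{1..N}. r i powr s)"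
      by (rule sum_mono)
    then show False using assms(3,8) by simp
  qed
  let ?H = "hausdorff_measure s :: 'a measure"
  note \<mu> = \<open>\<mu> = uniform_measure ?H C\<close>
  have sets_\<mu>: "sets \<mu> = sets borel" by (simp add: \<mu>)
  have space_\<mu>: "space \<mu> = UNIV" by (simp add: \<mu> uniform_measure_def)
  have em: "emeasure \<mu> A = emeasure ?H (C \<inter> A) / emeasure ?H C" if "A \<in> sets borel" for A
    unfolding \<mu> using that by (intro emeasure_uniform_measure) auto
  show ?thesis
  proof (cases "emeasure ?H C = 0 \<or> emeasure ?H C = top")
    case True
    text \<open>In the degenerate cases the convention \<open>0 / 0 = top / top = 0\<close> makes \<open>\<mu>\<close> vanish.\<close>
    then have "emeasure \<mu> UNIV = 0"
      by (auto simp: em)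
    then show ?thesis
      by (intro AE_I[of _ _ UNIV]) (auto simp: space_\<mu> sets_\<mu>)
  next
    case False
    obtain K where K: "0 \<le> K" "\<And>x y. x \<noteq> y \<Longrightarrow> \<bar>k x y\<bar> \<le> K / dist x y powr s"
      using homogeneous_kernel_bounded[OF doubling_imp_compact_cball assms(10)] assms(2) by blast
    interpret self_similar_singular_integral \<delta> S q r N C \<mu> s k K
    proof (intro self_similar_singular_integral.intro self_similar_measure.intro dilation_ifs_axioms
        self_similar_measure_axioms.intro self_similar_singular_integral_axioms.intro)
      have "emeasure \<mu> UNIV = 1"
        using False by (simp add: em ennreal_divide_self less_top)
      then show "finite_measure \<mu>" by (intro finite_measureI) (simp add: space_\<mu>)
      show "emeasure \<mu> (- C) = 0" by (simp add: em)
      fix i A assume i: "i \<in> {1..N}" and A: "A \<in> sets borel" "A \<subseteq> C"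
      have SA: "S i ` A \<in> sets borel"
        using ratio[OF i] A(1) by (simp add: map_similarity[OF i] borel_similarity_image)
      \<comment> \<open>Intersecting with \<open>C\<close>, as \<open>uniform_measure\<close> does,
        therefore leaves the image unchanged.\<close>
      have "S i ` A \<subseteq> C" using A(2) map_image_subset[OF i] by blast
      then have "emeasure \<mu> (S i ` A) = hausdorff_outer s (S i ` A) / emeasure ?H C"
        using SA by (simp add: em Int_absorb1 emeasure_hausdorff_measure)
      also have "hausdorff_outer s (S i ` A) = ennreal (r i powr s) * emeasure ?H A"
        using ratio[OF i] s A(1)
        by (simp add: map_similarity[OF i] hausdorff_outer_similarity emeasure_hausdorff_measure)
      also have "\<dots> / emeasure ?H C = ennreal (r i powr s) * emeasure \<mu> A"
        using A by (simp add: em Int_absorb1 ennreal_times_divide)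
      finally show "emeasure \<mu> (S i ` A) = ennreal (r i powr s) * emeasure \<mu> A" .
    qed (use sets_\<mu> assms(8,10) s K in auto)
    obtain w x U where "w \<in> words" "word_map S w x = x" "osc_for N S U" "x \<in> U"
      "(LINT y:(C - word_map S w ` C)|\<mu>. k x y) \<noteq> 0"
      using assms(11) by (auto simp: strong_osc_for_def)
    then show ?thesis by (intro maximal_integral_infinite)
  qed
qed

end
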